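(* Let $k$ be an $F$-finite field of characteristic $p>0$, let $S=k[x_1,\ldots,x_n]$, let $I\subset S$ be an ideal, let $R=S/I$, and let $\mathcal{D}\subseteq\mathcal{C}^R$ be a Cartier subalgebra of $R$. For each $e$ let $J_e=\Psi^{-1}(\mathcal{D}_e)$, where $\Psi\colon (I^{[p^e]}:I)/I^{[p^e]}\to\operatorname{Hom}_R(F^e_*R,R)$ is Fedder's isomorphism. Suppose that there are a fixed $t$ and, for each $e$, a choice of a minimal system of generators $(f_1,\ldots,f_{a_e})$ of $J_e$ such that $d(J_e):=\max_i\deg f_i$ satisfies $d(J_e)=\mathcal{O}(p^{te})$. Then $$\exp_F(\mathcal{D})\leq t\cdot n.$$
   Context: **Cartier algebras.** For an $F$-finite noetherian commutative ring $R$ of characteristic $p$ (i.e. $F_*R$ is a finite $R$-module, $F$ the Frobenius), the total Cartier algebra is $\mathcal{C}^R=\bigoplus_{e\geq 0}\mathcal{C}^R_e$ with $\mathcal{C}^R_e=\operatorname{Hom}_R(F^e_*R,R)$. It is a graded non-commutative ring with product $\varphi\cdot\psi=\varphi\circ F^a_*\psi$ for $\varphi\in\mathcal{C}^R_a$, $\psi\in\mathcal{C}^R_b$. Each $\mathcal{C}^R_e$ is an $R$-bimodule: $(r\cdot\varphi)(s)=r\varphi(s)$ and $(\varphi\cdot r)(s)=\varphi(rs)$, so $\varphi\cdot r^{p^e}=r\cdot\varphi$. A Cartier subalgebra of $R$ is a graded subring $\mathcal{D}\subseteq\mathcal{C}^R$ with $\mathcal{D}_0=R$ and $\mathcal{D}_e\neq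 0$ for some $e>0$. **Cartier operator and Fedder's isomorphism.** Fix an isomorphism $k\to\operatorname{Hom}_k(F_*k,k)$ (right $k$-module structure on the target) and let $\lambda\colon F_*k\to k$ be the corresponding map (the image of $1$); if $k$ is perfect one may take $\lambda$ to be the $p$-th root map. Let $\kappa^e\colon F^e_*S\to S$ be the $S$-linear map (i.e. additive with $\kappa^e(r^{p^e}s)=r\kappa^e(s)$) such that, for $c\in k$ and $0\leq\alpha_i\leq p^e-1$, $\kappa^e(cx^\alpha)=\lambda^e(c)$ if all $\alpha_i=p^e-1$, and $\kappa^e(cx^\alpha)=0$ otherwise; it generates $\operatorname{Hom}_S(F^e_*S,S)$ as a right $S$-module. Here $I^{[p^e]}$ is the ideal generated by the $p^e$-th powers of elements of $I$. Fedder's isomorphism $\Psi\colon (I^{[p^e]}:I)/I^{[p^e]}\to\operatorname{Hom}_R(F^e_*R,R)$ (of right $R$-modules) sends the class of $f$ to the map induced on $R=S/I$ by $s\mapsto\kappa^e(fs)$. A minimal system of generators of $J_e$ consists of polynomials $f_1,\ldots,f_{a_e}\in S$ whose classes form a minimal generating set of $J_e$ as a module; $\deg f_i$ is the total degree of the polynomial $f_i$. **Complexity and Frobenius exponent.** For $e\geq -1$ let $G_e=G_e(\mathcal{D})$ be the subring of $\mathcal{D}$ generated by the elements of degree $\leq e$ (with $G_{-1}=\mathcal{D}_0$), and let $k_e$ be the minimal number of homogeneous generators of $G_e$ as a ring over $\mathcal{D}_0=R$. The complexity of $\mathcal{D}$ is $\operatorname{cx}(\mathcal{D})=\inf\{m\in\mathbb{R}_{>0}: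 k_e-k_{e-1}=\mathcal{O}(m^e)\}$ (as $e\to\infty$), provided the $k_e$ are finite, with $\inf\varnothing=\infty$. The Frobenius exponent is $\exp_F(\mathcal{D})=\log_p(\operatorname{cx}(\mathcal{D}))$ (with $\log_p 0=-\infty$, $\log_p\infty=\infty$). *)

theory Defs
  imports
    "HOL-Library.Poly_Mapping"
    "HOL-Library.Extended_Real"
    "HOL-Library.Landau_Symbols"
    "HOL-Algebra.QuotRing"
    "HOL-Algebra.Generated_Rings"
begin

section \<open>Cartier algebras\<close>

text \<open>
  \<open>Hom\<^sub>R(F\<^sup>e\<^sub>*R, R)\<close> for a commutative ring \<open>R\<close> of characteristic \<open>p\<close>. As sets \<open>F\<^sup>e\<^sub>*R = R\<close>, and
  \<open>r\<close> acts on \<open>F\<^sup>e\<^sub>*R\<close> as multiplication by \<open>r\<^bsup>p\<^sup>e\<^esup>\<close>. Maps are extensional (\<open>undefined\<close> off the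
  carrier), so that two of them are equal iff they agree on the carrier.
\<close>

definition cartier_maps :: "nat \<Rightarrow> ('a, 'b) ring_scheme \<Rightarrow> nat \<Rightarrow> ('a \<Rightarrow> 'a) set" where
  "cartier_maps p R e =
     {\<phi> \<in> carrier R \<rightarrow>\<^sub>E carrier R.
        (\<forall>r\<in>carrier R. \<forall>s\<in>carrier R. \<phi> (r \<oplus>\<^bsub>R\<^esub> s) = \<phi> r \<oplus>\<^bsub>R\<^esub> \<phi> s) \<and>
        (\<forall>r\<in>carrier R. \<forall>s\<in>carrier R. \<phi> ((r [^]\<^bsub>R\<^esub> (p ^ e)) \<otimes>\<^bsub>R\<^esub> s) = r \<otimes>\<^bsub>R\<^esub> \<phi> s)}"

definition zero_map :: "('a, 'b) ring_scheme \<Rightarrow> 'a \<Rightarrow> 'a" where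
  "zero_map R = (\<lambda>s\<in>carrier R. \<zero>\<^bsub>R\<^esub>)"

definition homog :: "('a, 'b) ring_scheme \<Rightarrow> nat \<Rightarrow> ('a \<Rightarrow> 'a) \<Rightarrow> (nat \<Rightarrow> 'a \<Rightarrow> 'a)" where
  "homog R e \<phi> = (\<lambda>i. if i = e then \<phi> else zero_map R)"

text \<open>
  The total Cartier algebra: elements of the direct sum are finitely supported families
  \<open>\<Phi>\<close> with \<open>\<Phi> e \<in> Hom\<^sub>R(F\<^sup>e\<^sub>*R, R)\<close>. On underlying sets \<open>F\<^sup>a\<^sub>*\<psi> = \<psi>\<close>, so the product of homogeneous
  elements is composition, and the general product is the corresponding convolution.
\<close>

definition cartier_algebra :: "nat \<Rightarrow> ('a, 'b) ring_scheme \<Rightarrow> (nat \<Rightarrow> 'a \<Rightarrow> 'a) ring" where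
  "cartier_algebra p R =
     \<lparr>carrier = {\<Phi>. (\<forall>e. \<Phi> e \<in> cartier_maps p R e) \<and> finite {e. \<Phi> e \<noteq> zero_map R}},
      mult = (\<lambda>\<Phi> \<Psi> e. \<lambda>s\<in>carrier R. \<Oplus>\<^bsub>R\<^esub>a\<in>{..e}. \<Phi> a (\<Psi> (e - a) s)),
      one = homog R 0 (\<lambda>s\<in>carrier R. s),
      zero = (\<lambda>e. zero_map R),
      add = (\<lambda>\<Phi> \<Psi> e. \<lambda>s\<in>carrier R. \<Phi> e s \<oplus>\<^bsub>R\<^esub> \<Psi> e s)\<rparr>"

definition graded_piece :: "(nat \<Rightarrow> 'a \<Rightarrow> 'a) set \<Rightarrow> nat \<Rightarrow> ('a \<Rightarrow> 'a) set" where
  "graded_piece D e = (\<lambda>\<Phi>. \<Phi> e) ` D"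

text \<open>
  The condition \<open>D\<^sub>0 = R\<close> uses the identification of \<open>R\<close> with \<open>Hom\<^sub>R(R, R)\<close>, the degree-zero part of
  the total Cartier algebra.
\<close>

definition cartier_subalgebra ::
    "nat \<Rightarrow> ('a, 'b) ring_scheme \<Rightarrow> (nat \<Rightarrow> 'a \<Rightarrow> 'a) set \<Rightarrow> bool" where
  "cartier_subalgebra p R D \<longleftrightarrow>
     subring D (cartier_algebra p R) \<and>
     (\<forall>\<Phi>\<in>D. \<forall>e. homog R e (\<Phi> e) \<in> D) \<and>
     graded_piece D 0 = cartier_maps p R 0 \<and>
     (\<exists>e>0. graded_piece D e \<noteq> {zero_map R})"


section \<open>Complexity and Frobenius exponent\<close>

definition degree_le ::
    "('a, 'b) ring_scheme \<Rightarrow> (nat \<Rightarrow> 'a \<Rightarrow> 'a) set \<Rightarrow> int \<Rightarrow> (nat \<Rightarrow> 'a \<Rightarrow> 'a) set" where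
  "degree_le R D e = {\<Phi>\<in>D. \<forall>i. int i > e \<longrightarrow> \<Phi> i = zero_map R}"

text \<open>The index is an integer so that \<open>e = -1\<close> is allowed; \<open>degree_le R D 0\<close> is the subring \<open>D\<^sub>0\<close>.\<close>

definition cartier_G ::
    "nat \<Rightarrow> ('a, 'b) ring_scheme \<Rightarrow> (nat \<Rightarrow> 'a \<Rightarrow> 'a) set \<Rightarrow> int \<Rightarrow> (nat \<Rightarrow> 'a \<Rightarrow> 'a) set" where
  "cartier_G p R D e =
     (if e < 0 then degree_le R D 0
      else generate_ring (cartier_algebra p R) (degree_le R D e))"

definition homogeneous :: "nat \<Rightarrow> ('a, 'b) ring_scheme \<Rightarrow> (nat \<Rightarrow> 'a \<Rightarrow> 'a) set" where
  "homogeneous p R = {homog R e \<phi> | e \<phi>. \<phi> \<in> cartier_maps p R e}"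

text \<open>The value is \<open>\<infinity>\<close> if no finite set of homogeneous elements generates.\<close>

definition cartier_k ::
    "nat \<Rightarrow> ('a, 'b) ring_scheme \<Rightarrow> (nat \<Rightarrow> 'a \<Rightarrow> 'a) set \<Rightarrow> int \<Rightarrow> enat" where
  "cartier_k p R D e =
     (INF X \<in> {X. finite X \<and> X \<subseteq> homogeneous p R \<and>
                  generate_ring (cartier_algebra p R) (degree_le R D 0 \<union> X) = cartier_G p R D e}.
        enat (card X))"

text \<open>
  The complexity is only meaningful if all \<open>k\<^sub>e\<close> are finite; otherwise it is set to \<open>\<infinity>\<close>, so
  an upper bound on it includes the finiteness of the \<open>k\<^sub>e\<close>.
\<close>

definition cartier_complexity ::
    "nat \<Rightarrow> ('a, 'b) ring_scheme \<Rightarrow> (nat \<Rightarrow> 'a \<Rightarrow> 'a) set \<Rightarrow> ereal" where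
  "cartier_complexity p R D =
     (if \<exists>e. cartier_k p R D e = \<infinity> then \<infinity>
      else Inf {ereal m | m. m > 0 \<and>
             (\<lambda>e::nat. real (the_enat (cartier_k p R D (int e)))
                       - real (the_enat (cartier_k p R D (int e - 1)))) \<in> O(\<lambda>e. m ^ e)})"

definition ereal_log :: "real \<Rightarrow> ereal \<Rightarrow> ereal" where
  "ereal_log b x =
     (if x = \<infinity> then \<infinity> else if x \<le> 0 then -\<infinity> else ereal (log b (real_of_ereal x)))"

definition frobenius_exponent ::
    "nat \<Rightarrow> ('a, 'b) ring_scheme \<Rightarrow> (nat \<Rightarrow> 'a \<Rightarrow> 'a) set \<Rightarrow> ereal" where
  "frobenius_exponent p R D = ereal_log (real p) (cartier_complexity p R D)"


section \<open>Polynomial rings and the Cartier operator\<close>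

text \<open>
  Polynomials with coefficients in \<open>'k\<close> in countably many variables: an exponent vector is a
  finitely supported function \<open>nat \<Rightarrow>\<^sub>0 nat\<close>. The ring \<open>k[x\<^sub>1,\<dots>,x\<^sub>n]\<close> consists of those
  that only involve the variables with index \<open>< n\<close>.
\<close>

type_synonym 'k mpoly = "(nat \<Rightarrow>\<^sub>0 nat) \<Rightarrow>\<^sub>0 'k"

definition exponents :: "nat \<Rightarrow> (nat \<Rightarrow>\<^sub>0 nat) set" where
  "exponents n = {\<alpha>. Poly_Mapping.keys \<alpha> \<subseteq> {..<n}}"

definition poly_ring :: "nat \<Rightarrow> ('k::field) mpoly ring" where
  "poly_ring n = \<lparr>carrier = {f. Poly_Mapping.keys f \<subseteq> exponents n},
                  mult = (*), one = 1, zero = 0, add = (+)\<rparr>"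

definition total_degree :: "('k::field) mpoly \<Rightarrow> nat" where
  "total_degree f =
     Max (insert 0 ((\<lambda>\<alpha>. \<Sum>i\<in>Poly_Mapping.keys \<alpha>. Poly_Mapping.lookup \<alpha> i) ` Poly_Mapping.keys f))"

definition F_finite_field :: "('k::field) itself \<Rightarrow> bool" where
  "F_finite_field TYPE('k) \<longleftrightarrow>
     (\<exists>B::'k set. finite B \<and> (\<forall>c. \<exists>g. c = (\<Sum>b\<in>B. g b ^ CHAR('k) * b)))"

definition frobenius_dual :: "(('k::field) \<Rightarrow> 'k) set" where
  "frobenius_dual = {\<phi>. (\<forall>a b. \<phi> (a + b) = \<phi> a + \<phi> b) \<and> (\<forall>a b. \<phi> (a ^ CHAR('k) * b) = a * \<phi> b)}"

text \<open>
  An isomorphism \<open>k \<rightarrow> Hom\<^sub>k(F\<^sub>*k, k)\<close>, where the right module structure on the target is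
  \<open>(\<phi> \<cdot> c)(s) = \<phi>(c s)\<close>.
\<close>

definition frobenius_dual_iso :: "(('k::field) \<Rightarrow> 'k \<Rightarrow> 'k) \<Rightarrow> bool" where
  "frobenius_dual_iso \<theta> \<longleftrightarrow>
     bij_betw \<theta> UNIV frobenius_dual \<and>
     (\<forall>a b s. \<theta> (a + b) s = \<theta> a s + \<theta> b s) \<and>
     (\<forall>a c s. \<theta> (a * c) s = \<theta> a (c * s))"

definition cartier_operator ::
    "nat \<Rightarrow> (('k::field) \<Rightarrow> 'k) \<Rightarrow> (nat \<Rightarrow> 'k mpoly \<Rightarrow> 'k mpoly) \<Rightarrow> bool" where
  "cartier_operator n l \<kappa> \<longleftrightarrow>
     (\<forall>e. \<kappa> e \<in> cartier_maps CHAR('k) (poly_ring n) e \<and>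
        (\<forall>c. \<forall>\<alpha>\<in>exponents n.
           (\<forall>i<n. Poly_Mapping.lookup \<alpha> i \<le> CHAR('k) ^ e - 1) \<longrightarrow>
           \<kappa> e (Poly_Mapping.single \<alpha> c) =
             (if \<forall>i<n. Poly_Mapping.lookup \<alpha> i = CHAR('k) ^ e - 1
              then Poly_Mapping.single 0 ((l ^^ e) c) else 0)))"


section \<open>Fedder's isomorphism\<close>

definition frobenius_power :: "('a, 'b) ring_scheme \<Rightarrow> 'a set \<Rightarrow> nat \<Rightarrow> 'a set" where
  "frobenius_power S I q = genideal S ((\<lambda>f. f [^]\<^bsub>S\<^esub> q) ` I)"

definition colon_ideal :: "('a, 'b) ring_scheme \<Rightarrow> 'a set \<Rightarrow> 'a set \<Rightarrow> 'a set" where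
  "colon_ideal S J I = {f \<in> carrier S. \<forall>a\<in>I. f \<otimes>\<^bsub>S\<^esub> a \<in> J}"

text \<open>
  The map on cosets \<open>X\<close> of \<open>I\<^bsup>[p\<^sup>e]\<^esup>\<close>, for \<open>K = \<kappa>\<^sup>e\<close>. The union over representatives \<open>f\<close> and \<open>s\<close> is
  a union of equal cosets when \<open>f\<close> lies in \<open>(I\<^bsup>[p\<^sup>e]\<^esup> : I)\<close>.
\<close>

definition fedder_map ::
    "('a, 'b) ring_scheme \<Rightarrow> 'a set \<Rightarrow> ('a \<Rightarrow> 'a) \<Rightarrow> 'a set \<Rightarrow> ('a set \<Rightarrow> 'a set)" where
  "fedder_map S I K X =
     (\<lambda>Y\<in>carrier (S Quot I). \<Union>f\<in>X. \<Union>s\<in>Y. I +>\<^bsub>S\<^esub> K (f \<otimes>\<^bsub>S\<^esub> s))"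

definition fedder_domain :: "('a, 'b) ring_scheme \<Rightarrow> 'a set \<Rightarrow> nat \<Rightarrow> 'a set set" where
  "fedder_domain S I q =
     (let Q = frobenius_power S I q in (\<lambda>f. Q +>\<^bsub>S\<^esub> f) ` colon_ideal S Q I)"

definition fedder_preimage ::
    "nat \<Rightarrow> ('a, 'b) ring_scheme \<Rightarrow> 'a set \<Rightarrow> (nat \<Rightarrow> 'a \<Rightarrow> 'a) \<Rightarrow>
     (nat \<Rightarrow> 'a set \<Rightarrow> 'a set) set \<Rightarrow> nat \<Rightarrow> 'a set set" where
  "fedder_preimage p S I \<kappa> D e =
     {X \<in> fedder_domain S I (p ^ e). fedder_map S I (\<kappa> e) X \<in> graded_piece D e}"

text \<open>
  The polynomials in \<open>A\<close> represent an irredundant generating set of the module \<open>J\<close>, for \<open>J\<close> a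
  submodule of \<open>S/Q\<close>. The submodules of \<open>S/Q\<close> (over \<open>S\<close>, or over any quotient of \<open>S\<close> through which the action
  factors) are the ideals of the ring \<open>S/Q\<close>, so the submodule generated by a set of classes is
  the ideal that they generate. Taking proper subsets of \<open>A\<close> rather than of the set of classes
  also rules out two representatives of one class.
\<close>

definition minimal_generators ::
    "('a, 'b) ring_scheme \<Rightarrow> 'a set \<Rightarrow> 'a set set \<Rightarrow> 'a set \<Rightarrow> bool" where
  "minimal_generators S Q J A \<longleftrightarrow>
     finite A \<and> A \<subseteq> carrier S \<and>
     genideal (S Quot Q) ((\<lambda>f. Q +>\<^bsub>S\<^esub> f) ` A) = J \<and>
     (\<forall>B. B \<subset> A \<longrightarrow> genideal (S Quot Q) ((\<lambda>f. Q +>\<^bsub>S\<^esub> f) ` B) \<noteq> J)"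

text \<open>The maximum over the empty system (for \<open>J = 0\<close>) is taken to be \<open>0\<close>.\<close>

definition max_degree :: "('k::field) mpoly set \<Rightarrow> nat" where
  "max_degree A = Max (insert 0 (total_degree ` A))"

end

theory Submission
  imports Defs "HOL-Computational_Algebra.Primes"
begin

text \<open>
  Since \<open>k\<close> is \<open>F\<close>-finite, every \<open>s \<in> S\<close> has an expansion
  \<open>s = \<Sum>\<^sub>j \<kappa>\<^sup>e(v\<^sub>j s)\<^bsup>p\<^sup>e\<^esup> u\<^sub>j\<close>, and this makes Fedder's map surjective. Hence adjoining the images of an
  irredundant generating system of \<open>J\<^sub>e\<close> to ring generators of \<open>G\<^sub>e\<^sub>-\<^sub>1\<close> gives ring generators of \<open>G\<^sub>e\<close>.
  Conversely the generators of \<open>G\<^sub>e\<close> of degree below \<open>e\<close> generate \<open>G\<^sub>e\<^sub>-\<^sub>1\<close>, so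
  \<open>0 \<le> k\<^sub>e - k\<^sub>e\<^sub>-\<^sub>1 \<le> a\<^sub>e\<close>. An irredundant system is linearly independent over \<open>k\<close>, and a space of
  polynomials of degree at most \<open>d\<close> has dimension at most \<open>(d + 1)\<^sup>n\<close>; for \<open>t \<ge> 0\<close> this is the claim.

  For \<open>t < 0\<close> and \<open>n > 0\<close> the bound on the exponent is negative, so \<open>k\<^sub>e = k\<^sub>e\<^sub>-\<^sub>1\<close> is needed for
  large \<open>e\<close>. There all generators are constants, so \<open>J\<^sub>e\<close> is either zero or generated by \<open>1\<close>. The
  degrees \<open>e\<close> with \<open>1 \<in> J\<^sub>e\<close> form an additive semigroup because \<open>\<kappa>\<^sup>a \<kappa>\<^sup>b = \<kappa>\<^bsup>a+b\<^esup>\<close>, and large elements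
  of such a semigroup are sums of smaller ones.
\<close>

section \<open>Cartier maps and the Cartier algebra\<close>

context cring
begin

lemma cartier_maps_closed:
  assumes "\<phi> \<in> cartier_maps p R e" and "s \<in> carrier R"
  shows "\<phi> s \<in> carrier R"
  using assms by (auto simp: cartier_maps_def)

lemma cartier_maps_add:
  assumes "\<phi> \<in> cartier_maps p R e" and "r \<in> carrier R" "s \<in> carrier R"
  shows "\<phi> (r \<oplus> s) = \<phi> r \<oplus> \<phi> s"
  using assms by (auto simp: cartier_maps_def)

lemma cartier_maps_pow:
  assumes "\<phi> \<in> cartier_maps p R e" and "r \<in> carrier R" "s \<in> carrier R"
  shows "\<phi> ((r [^] (p ^ e)) \<otimes> s) = r \<otimes> \<phi> s"
  using assms by (auto simp: cartier_maps_def)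

lemma cartier_maps_extensional:
  assumes "\<phi> \<in> cartier_maps p R e"
  shows "\<phi> \<in> extensional (carrier R)"
  using assms by (auto simp: cartier_maps_def PiE_def)

lemma cartier_maps_zero:
  assumes "\<phi> \<in> cartier_maps p R e"
  shows "\<phi> \<zero> = \<zero>"
proof -
  have "\<phi> \<zero> \<oplus> \<phi> \<zero> = \<phi> \<zero> \<oplus> \<zero>"
    using cartier_maps_add[OF assms, of \<zero> \<zero>] cartier_maps_closed[OF assms, of \<zero>] by simp
  then show ?thesis
    using cartier_maps_closed[OF assms, of \<zero>] by (simp del: r_zero)
qed

lemma cartier_maps_finsum:
  assumes "\<phi> \<in> cartier_maps p R e" and "finite J" and "g \<in> J \<rightarrow> carrier R"
  shows "\<phi> (\<Oplus>j\<in>J. g j) = (\<Oplus>j\<in>J. \<phi> (g j))"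
  using assms(2,3)
proof (induction J rule: finite_induct)
  case empty
  then show ?case by (simp add: cartier_maps_zero[OF assms(1)])
next
  case (insert j J)
  have g: "g \<in> J \<rightarrow> carrier R" "g j \<in> carrier R" using insert by auto
  have "(\<lambda>j. \<phi> (g j)) \<in> J \<rightarrow> carrier R" "\<phi> (g j) \<in> carrier R"
    using g cartier_maps_closed[OF assms(1)] by auto
  with insert g show ?case
    by (simp add: finsum_insert cartier_maps_add[OF assms(1)] finsum_closed)
qed

lemma zero_map_apply [simp]: "s \<in> carrier R \<Longrightarrow> zero_map R s = \<zero>"
  by (simp add: zero_map_def)

text \<open>For exponent zero the twist \<open>p ^ 0\<close> is one, so degree-zero maps are
  ordinary \<open>R\<close>-linear maps. These multiplications are how scalars enter the Cartier
  algebra.\<close>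

lemma mult_in_cartier_maps_0:
  assumes "r \<in> carrier R"
  shows "(\<lambda>s\<in>carrier R. r \<otimes> s) \<in> cartier_maps p R 0"
  using assms by (auto simp: cartier_maps_def r_distr m_assoc m_lcomm)

lemma uminus_in_cartier_maps:
  assumes "\<phi> \<in> cartier_maps p R e"
  shows "(\<lambda>s\<in>carrier R. \<ominus> \<phi> s) \<in> cartier_maps p R e"
proof -
  note [simp] = cartier_maps_closed[OF assms] cartier_maps_add[OF assms] cartier_maps_pow[OF assms]
  show ?thesis by (auto simp: cartier_maps_def minus_add r_minus)
qed

lemma cartier_algebra_simps:
  "zero (cartier_algebra p R) = (\<lambda>e. zero_map R)"
  "one (cartier_algebra p R) = homog R 0 (\<lambda>s\<in>carrier R. s)"
  "add (cartier_algebra p R) \<Phi> \<Psi> = (\<lambda>e. \<lambda>s\<in>carrier R. \<Phi> e s \<oplus> \<Psi> e s)"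
  "monoid.mult (cartier_algebra p R) \<Phi> \<Psi> = (\<lambda>e. \<lambda>s\<in>carrier R. \<Oplus>a\<in>{..e}. \<Phi> a (\<Psi> (e - a) s))"
  by (simp_all add: cartier_algebra_def)

lemma cartier_algebra_component:
  assumes "\<Phi> \<in> carrier (cartier_algebra p R)"
  shows "\<Phi> e \<in> cartier_maps p R e"
  using assms by (simp add: cartier_algebra_def)

text \<open>The Cartier algebra is not established as a ring here, so the inverse is identified
  directly from the definite description in \<open>m_inv_def\<close>. Uniqueness uses
  extensionality: off the carrier both maps are \<open>undefined\<close>.\<close>

lemma cartier_algebra_a_inv:
  assumes "\<Phi> \<in> carrier (cartier_algebra p R)"
  shows "a_inv (cartier_algebra p R) \<Phi> = (\<lambda>e. \<lambda>s\<in>carrier R. \<ominus> \<Phi> e s)"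
proof -
  let ?C = "cartier_algebra p R" and ?N = "\<lambda>e. \<lambda>s\<in>carrier R. \<ominus> \<Phi> e s"
  have \<Phi>: "\<Phi> e \<in> cartier_maps p R e" for e
    using assms by (rule cartier_algebra_component)
  have "{e. ?N e \<noteq> zero_map R} \<subseteq> {e. \<Phi> e \<noteq> zero_map R}"
    by (auto simp: zero_map_def)
  then have N: "?N \<in> carrier ?C"
    using assms uminus_in_cartier_maps[OF \<Phi>]
    by (auto simp: cartier_algebra_def intro: finite_subset)
  have cl: "\<Phi> e s \<in> carrier R" if "s \<in> carrier R" for e s
    using cartier_maps_closed[OF \<Phi> that] .
  show ?thesis
    unfolding a_inv_def[of ?C] m_inv_def[of "add_monoid ?C"]
  proof (rule the_equality, goal_cases)
    case 1
    then show ?case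
      using N cl by (simp add: cartier_algebra_simps zero_map_def fun_eq_iff l_neg r_neg restrict_def)
  next
    case (2 Y)
    then have Y: "Y e \<in> cartier_maps p R e" for e by (auto intro: cartier_algebra_component)
    have sum0: "Y e s \<oplus> \<Phi> e s = \<zero>" if "s \<in> carrier R" for e s
    proof -
      have "add ?C Y \<Phi> e s = zero ?C e s" using 2 by simp
      then show ?thesis using that by (simp add: cartier_algebra_simps)
    qed
    have "Y e s = ?N e s" for e s
    proof (cases "s \<in> carrier R")
      case True
      then show ?thesis
        using minus_equality[OF sum0[OF True, of e]] cl cartier_maps_closed[OF Y True] by simp
    next
      case False
      then show ?thesis
        using cartier_maps_extensional[OF Y, of e] by (simp add: extensional_def)
    qed
    then show ?case by (simp add: fun_eq_iff)
  qed
qed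

text \<open>Only the index \<open>a\<close> can contribute to the convolution. Subtraction is
  truncated, so \<open>e - a = b\<close> means \<open>e = a + b\<close> only if
  \<open>a \<le> e\<close>; this forces the case split.\<close>

lemma homog_mult:
  assumes \<phi>: "\<phi> \<in> cartier_maps p R a" and \<psi>: "\<psi> \<in> cartier_maps p R b"
  shows "homog R a \<phi> \<otimes>\<^bsub>cartier_algebra p R\<^esub> homog R b \<psi>
           = homog R (a + b) (\<lambda>s\<in>carrier R. \<phi> (\<psi> s))"
proof (rule ext)
  fix e
  show "(homog R a \<phi> \<otimes>\<^bsub>cartier_algebra p R\<^esub> homog R b \<psi>) e
           = homog R (a + b) (\<lambda>s\<in>carrier R. \<phi> (\<psi> s)) e"
  proof (rule extensionalityI[where A = "carrier R"])
    fix s assume s: "s \<in> carrier R"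
    have cl: "\<phi> (\<psi> s) \<in> carrier R" "\<psi> s \<in> carrier R"
      using s cartier_maps_closed \<phi> \<psi> by auto
    have *: "homog R a \<phi> i (homog R b \<psi> (e - i) s)
             = (if i = a then if e - i = b then \<phi> (\<psi> s) else \<zero> else \<zero>)" for i
      using s cl cartier_maps_zero[OF \<phi>] by (auto simp: homog_def)
    have "(\<Oplus>i\<in>{..e}. homog R a \<phi> i (homog R b \<psi> (e - i) s))
            = (\<Oplus>i\<in>{..e}. if a = i then if e - a = b then \<phi> (\<psi> s) else \<zero> else \<zero>)"
      unfolding * by (rule finsum_cong') (use cl in auto)
    also have "\<dots> = (if e = a + b then \<phi> (\<psi> s) else \<zero>)"
    proof (cases "a \<le> e")
      case True
      have "(\<Oplus>i\<in>{..e}. if a = i then if e - a = b then \<phi> (\<psi> s) else \<zero> else \<zero>)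
              = (if e - a = b then \<phi> (\<psi> s) else \<zero>)"
        using add.finprod_singleton[of a "{..e}" "\<lambda>i. if e - a = b then \<phi> (\<psi> s) else \<zero>"] True cl
        by (simp add: finsum_def)
      with True show ?thesis by auto
    next
      case False
      have "(\<Oplus>i\<in>{..e}. if a = i then if e - a = b then \<phi> (\<psi> s) else \<zero> else \<zero>)
              = (\<Oplus>i\<in>{..e}. \<zero>)"
        by (rule finsum_cong') (use cl False in auto)
      with False show ?thesis by (auto simp: add.finprod_one_eqI)
    qed
    finally show "(homog R a \<phi> \<otimes>\<^bsub>cartier_algebra p R\<^esub> homog R b \<psi>) e s
           = homog R (a + b) (\<lambda>s\<in>carrier R. \<phi> (\<psi> s)) e s"
      using s by (simp add: cartier_algebra_simps homog_def)
  qed (auto simp: cartier_algebra_simps homog_def zero_map_def)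
qed

lemma homog_zero_map: "homog R e (zero_map R) = zero (cartier_algebra p R)"
  by (auto simp: homog_def cartier_algebra_simps)

lemma homog_add:
  "homog R e \<phi> \<oplus>\<^bsub>cartier_algebra p R\<^esub> homog R e \<psi> = homog R e (\<lambda>s\<in>carrier R. \<phi> s \<oplus> \<psi> s)"
  by (auto simp: homog_def cartier_algebra_simps zero_map_def fun_eq_iff restrict_def)

lemma homog_a_inv:
  assumes "homog R e \<phi> \<in> carrier (cartier_algebra p R)"
  shows "\<ominus>\<^bsub>cartier_algebra p R\<^esub> homog R e \<phi> = homog R e (\<lambda>s\<in>carrier R. \<ominus> \<phi> s)"
  unfolding cartier_algebra_a_inv[OF assms]
  by (auto simp: homog_def zero_map_def fun_eq_iff restrict_def)

end

section \<open>Generated subrings and homogeneous components\<close>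

lemma generate_ring_subsetI:
  assumes "H \<subseteq> generate_ring R K"
  shows "generate_ring R H \<subseteq> generate_ring R K"
proof
  fix x assume "x \<in> generate_ring R H"
  then show "x \<in> generate_ring R K"
    by induction (use assms in \<open>auto intro: generate_ring.intros\<close>)
qed

lemma generate_ring_mono: "H \<subseteq> K \<Longrightarrow> generate_ring R H \<subseteq> generate_ring R K"
  by (rule generate_ring_subsetI) (auto intro: generate_ring.incl)

locale cartier_sub = cring R for R (structure) +
  fixes p :: nat and D
  assumes cartier_subalgebra: "cartier_subalgebra p R D"
begin

abbreviation "CA \<equiv> cartier_algebra p R"
abbreviation "gen \<equiv> generate_ring CA"

lemma subring_D: "subring D CA"
  using cartier_subalgebra by (simp add: cartier_subalgebra_def)

lemma D_closed:
  "\<Phi> \<in> D \<Longrightarrow> \<Phi> \<in> carrier CA"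
  "one CA \<in> D"
  "\<Phi> \<in> D \<Longrightarrow> a_inv CA \<Phi> \<in> D"
  "\<Phi> \<in> D \<Longrightarrow> \<Psi> \<in> D \<Longrightarrow> add CA \<Phi> \<Psi> \<in> D"
  "\<Phi> \<in> D \<Longrightarrow> \<Psi> \<in> D \<Longrightarrow> monoid.mult CA \<Phi> \<Psi> \<in> D"
proof -
  interpret subring D CA by (rule subring_D)
  show "\<Phi> \<in> D \<Longrightarrow> \<Phi> \<in> carrier CA" using subset by auto
  show "one CA \<in> D" by auto
  show "\<Phi> \<in> D \<Longrightarrow> a_inv CA \<Phi> \<in> D" using m_inv_closed by (simp add: a_inv_def)
  show "\<Phi> \<in> D \<Longrightarrow> \<Psi> \<in> D \<Longrightarrow> add CA \<Phi> \<Psi> \<in> D"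
    using subgroup.m_closed[OF subgroup_axioms, of \<Phi> \<Psi>] by simp
  show "\<Phi> \<in> D \<Longrightarrow> \<Psi> \<in> D \<Longrightarrow> monoid.mult CA \<Phi> \<Psi> \<in> D" by auto
qed

lemma D_component: "\<Phi> \<in> D \<Longrightarrow> \<Phi> e \<in> cartier_maps p R e"
  by (rule cartier_algebra_component) (rule D_closed)

lemma homog_component_in_D: "\<Phi> \<in> D \<Longrightarrow> homog R e (\<Phi> e) \<in> D"
  using cartier_subalgebra by (simp add: cartier_subalgebra_def)

lemma graded_piece_iff: "\<phi> \<in> graded_piece D e \<longleftrightarrow> homog R e \<phi> \<in> D"
proof
  assume "\<phi> \<in> graded_piece D e"
  then show "homog R e \<phi> \<in> D"
    using homog_component_in_D by (auto simp: graded_piece_def)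
next
  assume "homog R e \<phi> \<in> D"
  then show "\<phi> \<in> graded_piece D e"
    unfolding graded_piece_def by (rule rev_image_eqI) (simp add: homog_def)
qed

lemma homog_0_in_D:
  assumes "\<phi> \<in> cartier_maps p R 0"
  shows "homog R 0 \<phi> \<in> D"
  using assms cartier_subalgebra graded_piece_iff by (auto simp: cartier_subalgebra_def)

lemma homog_0_in_degree_le:
  assumes "\<phi> \<in> cartier_maps p R 0"
  shows "homog R 0 \<phi> \<in> degree_le R D 0"
  using homog_0_in_D[OF assms] by (auto simp: degree_le_def homog_def)

lemma degree_le_subset: "degree_le R D e \<subseteq> D"
  by (auto simp: degree_le_def)

lemma degree_le_mono: "e \<le> e' \<Longrightarrow> degree_le R D e \<subseteq> degree_le R D e'"
  by (auto simp: degree_le_def)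

lemma generate_subset_D:
  assumes "H \<subseteq> D"
  shows "gen H \<subseteq> D"
proof
  fix \<Phi> assume "\<Phi> \<in> gen H"
  then show "\<Phi> \<in> D"
    by induction (use assms in \<open>auto intro: D_closed\<close>)
qed

text \<open>\<open>generate_ring\<close> has no clause for zero; it arises as one plus its
  negative.\<close>

lemma zero_in_generate_ring: "zero CA \<in> gen H"
proof -
  have "one CA \<oplus>\<^bsub>CA\<^esub> \<ominus>\<^bsub>CA\<^esub> one CA = zero CA"
    unfolding cartier_algebra_a_inv[OF D_closed(1)[OF D_closed(2)]]
    by (auto simp: cartier_algebra_simps fun_eq_iff restrict_def zero_map_def homog_def r_neg)
  then show ?thesis
    by (metis generate_ring.intros(1,3,4))
qed

lemma homog_zero_map_in_generate_ring: "homog R e (zero_map R) \<in> gen H"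
  unfolding homog_zero_map[of e p] by (rule zero_in_generate_ring)

text \<open>An element is the finite sum of its homogeneous components; the truncations
  \<open>tr j\<close> are the partial sums, each obtained from the previous one by one
  addition.\<close>

lemma generate_ring_of_components:
  assumes "\<Phi> \<in> D" and "\<And>i. i \<le> m \<Longrightarrow> homog R i (\<Phi> i) \<in> gen H"
    and "\<And>i. i > m \<Longrightarrow> \<Phi> i = zero_map R"
  shows "\<Phi> \<in> gen H"
proof -
  have cl: "\<Phi> i s \<in> carrier R" if "s \<in> carrier R" for i s
    using cartier_maps_closed[OF D_component[OF assms(1)] that] .
  have ext: "\<Phi> i s = undefined" if "s \<notin> carrier R" for i s
    using cartier_maps_extensional[OF D_component[OF assms(1)]] that by (simp add: extensional_def)
  define tr where "tr j = (\<lambda>i. if i \<le> j then \<Phi> i else zero_map R)" for j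
  have step: "tr (Suc j) = tr j \<oplus>\<^bsub>CA\<^esub> homog R (Suc j) (\<Phi> (Suc j))" for j
    using cl ext
    by (auto simp: tr_def fun_eq_iff cartier_algebra_simps homog_def zero_map_def restrict_def
        le_Suc_eq)
  have "j \<le> m \<Longrightarrow> tr j \<in> gen H" for j
  proof (induction j)
    case 0
    have "tr 0 = homog R 0 (\<Phi> 0)" by (auto simp: tr_def homog_def)
    with assms(2)[of 0] show ?case by simp
  next
    case (Suc j)
    then show ?case unfolding step by (intro generate_ring.eng_add assms(2)) auto
  qed
  moreover have "tr m = \<Phi>"
    using assms(3) by (auto simp: tr_def fun_eq_iff)
  ultimately show ?thesis by auto
qed

text \<open>The degree-\<open>i\<close> component of a product is a sum of products of components of
  degrees \<open>a\<close> and \<open>i - a\<close>, neither of which exceeds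
  \<open>i\<close>.\<close>

lemma homog_mult_component_in_generate_ring:
  assumes "K \<subseteq> D" and "\<Phi> \<in> D" "\<Psi> \<in> D"
    and "\<And>j. j \<le> i \<Longrightarrow> homog R j (\<Phi> j) \<in> gen K"
    and "\<And>j. j \<le> i \<Longrightarrow> homog R j (\<Psi> j) \<in> gen K"
  shows "homog R i ((\<Phi> \<otimes>\<^bsub>CA\<^esub> \<Psi>) i) \<in> gen K"
proof -
  have cl: "\<Phi> a (\<Psi> b s) \<in> carrier R" if "s \<in> carrier R" for a b s
    using cartier_maps_closed D_component assms that by blast
  \<comment> \<open>Allowing any subset \<open>F\<close> of \<open>{..i}\<close> turns the
    convolution sum into an induction over finite sets.\<close>
  have "homog R i (\<lambda>s\<in>carrier R. \<Oplus>a\<in>F. \<Phi> a (\<Psi> (i - a) s)) \<in> gen K"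
    if "finite F" "F \<subseteq> {..i}" for F
    using that
  proof (induction F rule: finite_induct)
    case empty
    have "(\<lambda>s\<in>carrier R. \<Oplus>a\<in>{}. \<Phi> a (\<Psi> (i - a) s)) = zero_map R"
      unfolding zero_map_def by (rule restrict_ext) simp
    then show ?case
      using homog_zero_map_in_generate_ring[of i K] by (simp only:)
  next
    case (insert a F)
    have "homog R (a + (i - a)) (\<lambda>s\<in>carrier R. \<Phi> a (\<Psi> (i - a) s)) \<in> gen K"
      unfolding homog_mult[OF D_component[OF assms(2)] D_component[OF assms(3)], symmetric]
      using insert.prems assms(4,5) by (intro generate_ring.eng_mult) auto
    moreover have "a + (i - a) = i" using insert.prems by simp
    ultimately have "homog R i (\<lambda>s\<in>carrier R. \<Phi> a (\<Psi> (i - a) s)) \<in> gen K" by (simp only:)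
    then have "homog R i (\<lambda>s\<in>carrier R. \<Phi> a (\<Psi> (i - a) s)) \<oplus>\<^bsub>CA\<^esub>
       homog R i (\<lambda>s\<in>carrier R. \<Oplus>a\<in>F. \<Phi> a (\<Psi> (i - a) s)) \<in> gen K"
      by (rule generate_ring.eng_add) (use insert.IH insert.prems in blast)
    moreover have "(\<lambda>s\<in>carrier R. \<Oplus>a\<in>insert a F. \<Phi> a (\<Psi> (i - a) s)) =
      (\<lambda>s\<in>carrier R. (\<lambda>s\<in>carrier R. \<Phi> a (\<Psi> (i - a) s)) s
        \<oplus> (\<lambda>s\<in>carrier R. \<Oplus>a\<in>F. \<Phi> a (\<Psi> (i - a) s)) s)"
      by (rule restrict_ext) (use insert cl in \<open>simp add: finsum_insert Pi_def\<close>)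
    ultimately show ?case
      unfolding homog_add by (simp only:)
  qed
  from this[of "{..i}"] show ?thesis by (simp add: cartier_algebra_simps)
qed

text \<open>Degrees are nonnegative, so the components up to \<open>m\<close> of a ring expression
  involve only the components up to \<open>m\<close> of the generators. This is what later allows
  generators of higher degree to be discarded.\<close>

lemma homog_component_in_generate_ring:
  assumes "H \<subseteq> D" "K \<subseteq> D"
    and H: "\<And>\<Phi> i. \<Phi> \<in> H \<Longrightarrow> i \<le> m \<Longrightarrow> homog R i (\<Phi> i) \<in> gen K"
    and "\<Phi> \<in> gen H" "i \<le> m"
  shows "homog R i (\<Phi> i) \<in> gen K"
  using assms(4,5)
proof (induction arbitrary: i)
  case one
  have "homog R 0 (\<lambda>s\<in>carrier R. s) \<in> gen K"
    using generate_ring.one[of CA K] by (simp add: cartier_algebra_simps)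
  then show ?case
    using homog_zero_map_in_generate_ring[of i K] by (simp add: cartier_algebra_simps homog_def)
next
  case (incl h)
  then show ?case using H by blast
next
  case (a_inv h)
  then have h: "h \<in> D" using generate_subset_D[OF assms(1)] by auto
  have "\<ominus>\<^bsub>CA\<^esub> homog R i (h i) \<in> gen K"
    using a_inv by (intro generate_ring.a_inv) auto
  then show ?case
    unfolding homog_a_inv[OF D_closed(1)[OF homog_component_in_D[OF h]]]
      cartier_algebra_a_inv[OF D_closed(1)[OF h]] .
next
  case (eng_add h1 h2)
  then have "homog R i (h1 i) \<oplus>\<^bsub>CA\<^esub> homog R i (h2 i) \<in> gen K"
    by (intro generate_ring.eng_add) auto
  then show ?case unfolding homog_add by (simp only: cartier_algebra_simps(3))
next
  case (eng_mult h1 h2)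
  then show ?case
    using generate_subset_D[OF assms(1)] assms(2)
    by (intro homog_mult_component_in_generate_ring) auto
qed

section \<open>Minimal numbers of ring generators\<close>

abbreviation "k \<equiv> cartier_k p R D"

definition ring_generators where
  "ring_generators e X \<longleftrightarrow> finite X \<and> X \<subseteq> homogeneous p R \<and>
     gen (degree_le R D 0 \<union> X) = cartier_G p R D e"

lemma k_le: "ring_generators e X \<Longrightarrow> k e \<le> enat (card X)"
  unfolding cartier_k_def ring_generators_def by (auto intro: INF_lower)

text \<open>An infimum over the empty set would be \<open>\<infinity>\<close>, and a nonempty set of
  extended naturals contains its infimum by well-ordering.\<close>

lemma k_attained:
  assumes "k e \<noteq> \<infinity>"
  obtains X where "ring_generators e X" and "k e = enat (card X)"
proof -
  let ?Z = "(\<lambda>X. enat (card X)) ` {X. ring_generators e X}"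
  have k: "k e = Inf ?Z" by (simp add: cartier_k_def ring_generators_def)
  with assms have "?Z \<noteq> {}" by (auto simp: top_enat_def[symmetric])
  then obtain z where "z \<in> ?Z" by auto
  then have "Inf ?Z \<in> ?Z" by (rule wellorder_InfI)
  with k that show thesis by auto
qed

text \<open>The degree-zero part is already a subring. This makes both branches of
  \<open>cartier_G\<close> agree at \<open>e = 0\<close> and \<open>e = -1\<close>.\<close>

lemma generate_degree_le_0: "gen (degree_le R D 0) = degree_le R D 0"
proof
  show "degree_le R D 0 \<subseteq> gen (degree_le R D 0)" by (auto intro: generate_ring.incl)
  show "gen (degree_le R D 0) \<subseteq> degree_le R D 0"
  proof
    fix \<Phi> assume "\<Phi> \<in> gen (degree_le R D 0)"
    then show "\<Phi> \<in> degree_le R D 0"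
    proof induction
      case one
      then show ?case
        using D_closed(2) by (auto simp: degree_le_def cartier_algebra_simps homog_def)
    next
      case (a_inv h)
      then have h: "h \<in> D" by (simp add: degree_le_def)
      have "h i = zero_map R" if "i > 0" for i
        using a_inv that by (simp add: degree_le_def)
      then have "(\<ominus>\<^bsub>CA\<^esub> h) i = zero_map R" if "i > 0" for i
        unfolding cartier_algebra_a_inv[OF D_closed(1)[OF h]] using that
        by (subst zero_map_def) (auto intro: restrict_ext)
      with h show ?case by (auto simp: degree_le_def D_closed)
    next
      case (eng_add h1 h2)
      then have h: "h1 \<in> D" "h2 \<in> D" by (simp_all add: degree_le_def)
      have "h1 i = zero_map R" "h2 i = zero_map R" if "i > 0" for i
        using eng_add that by (simp_all add: degree_le_def)
      then have "(h1 \<oplus>\<^bsub>CA\<^esub> h2) i = zero_map R" if "i > 0" for i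
        unfolding cartier_algebra_simps using that
        by (subst zero_map_def) (auto intro: restrict_ext)
      with h show ?case by (auto simp: degree_le_def D_closed)
    next
      case (eng_mult h1 h2)
      have "(h1 \<otimes>\<^bsub>CA\<^esub> h2) i = zero_map R" if "i > 0" for i
      proof -
        have "(\<Oplus>a\<in>{..i}. h1 a (h2 (i - a) s)) = \<zero>" if s: "s \<in> carrier R" for s
        proof -
          \<comment> \<open>As \<open>i > 0\<close>, one of the degrees \<open>a\<close> and
            \<open>i - a\<close> is positive, and the factor in that degree vanishes.\<close>
          have "h1 a (h2 (i - a) s) = \<zero>" if "a \<le> i" for a
          proof (cases "a = 0")
            case True
            then have "h2 (i - a) = zero_map R" using eng_mult \<open>i > 0\<close> by (auto simp: degree_le_def)
            then show ?thesis
              using s eng_mult by (simp add: degree_le_def cartier_maps_zero[OF D_component])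
          next
            case False
            then have "h1 a = zero_map R" using eng_mult by (auto simp: degree_le_def)
            then show ?thesis
              using s eng_mult cartier_maps_closed[OF D_component] by (simp add: degree_le_def)
          qed
          then show ?thesis by (auto intro: add.finprod_one_eqI)
        qed
        then show ?thesis by (auto simp: cartier_algebra_simps zero_map_def intro: restrict_ext)
      qed
      with eng_mult show ?case by (auto simp: degree_le_def D_closed)
    qed auto
  qed
qed

lemma cartier_G_0: "e \<le> 0 \<Longrightarrow> cartier_G p R D e = degree_le R D 0"
  by (auto simp: cartier_G_def generate_degree_le_0)

lemma cartier_G_eq: "-1 \<le> e \<Longrightarrow> cartier_G p R D e = gen (degree_le R D (max e 0))"
  by (auto simp: cartier_G_def generate_degree_le_0 max_def)

text \<open>Generators are counted over the degree-zero part, so the empty system suffices.\<close>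

lemma k_nonpos: "e \<le> 0 \<Longrightarrow> k e = 0"
  using k_le[of e "{}"]
  by (simp add: ring_generators_def cartier_G_0 generate_degree_le_0 zero_enat_def[symmetric])

lemma degree_le_Suc_subset:
  assumes "degree_le R D (int e) \<subseteq> gen H"
    and "\<And>\<phi>. \<phi> \<in> graded_piece D (Suc e) \<Longrightarrow> homog R (Suc e) \<phi> \<in> gen H"
  shows "degree_le R D (int (Suc e)) \<subseteq> gen H"
proof
  fix \<Phi> assume \<Phi>: "\<Phi> \<in> degree_le R D (int (Suc e))"
  then have "\<Phi> \<in> D" using degree_le_subset by auto
  have "homog R i (\<Phi> i) \<in> gen H" if "i \<le> Suc e" for i
  proof (cases "i = Suc e")
    case True
    with \<open>\<Phi> \<in> D\<close> show ?thesis by (auto intro!: assms(2) simp: graded_piece_def)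
  next
    case False
    with that have "homog R i (\<Phi> i) \<in> degree_le R D (int e)"
      using homog_component_in_D[OF \<open>\<Phi> \<in> D\<close>] by (auto simp: degree_le_def homog_def)
    with assms(1) show ?thesis by auto
  qed
  moreover have "\<Phi> i = zero_map R" if "i > Suc e" for i
    using \<Phi> that by (simp add: degree_le_def)
  ultimately show "\<Phi> \<in> gen H"
    using \<open>\<Phi> \<in> D\<close> by (intro generate_ring_of_components[of \<Phi> "Suc e"])
qed

lemma ring_generators_subset:
  assumes "ring_generators e X" and "-1 \<le> e"
  shows "X \<subseteq> D"
proof -
  have "X \<subseteq> gen (degree_le R D 0 \<union> X)" by (auto intro: generate_ring.incl)
  also have "\<dots> = gen (degree_le R D (max e 0))"
    using assms by (simp add: ring_generators_def cartier_G_eq)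
  also have "\<dots> \<subseteq> D" by (intro generate_subset_D degree_le_subset)
  finally show ?thesis .
qed

text \<open>Upper estimate for one step: an element of degree at most \<open>Suc e\<close> is its
  top component, reached through \<open>Y\<close>, plus components of degree at most
  \<open>e\<close>, reached through \<open>X\<close>.\<close>

lemma k_Suc_le:
  assumes X: "ring_generators (int e) X" and Y: "finite Y" "Y \<subseteq> graded_piece D (Suc e)"
    and gen: "\<And>\<phi>. \<phi> \<in> graded_piece D (Suc e) \<Longrightarrow>
      homog R (Suc e) \<phi> \<in> gen (degree_le R D 0 \<union> homog R (Suc e) ` Y)"
  shows "k (int (Suc e)) \<le> enat (card X + card Y)"
proof -
  let ?Y = "homog R (Suc e) ` Y"
  have "ring_generators (int (Suc e)) (X \<union> ?Y)"
    unfolding ring_generators_def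
  proof (intro conjI)
    show "finite (X \<union> ?Y)" using X Y by (simp add: ring_generators_def)
    have YD: "?Y \<subseteq> D" using Y graded_piece_iff by auto
    have "\<phi> \<in> cartier_maps p R (Suc e)" if "\<phi> \<in> graded_piece D (Suc e)" for \<phi>
      using that by (auto simp: graded_piece_def intro: D_component)
    with X Y show "X \<union> ?Y \<subseteq> homogeneous p R"
      by (auto simp: ring_generators_def homogeneous_def)
    have GX: "gen (degree_le R D 0 \<union> X) = gen (degree_le R D (int e))"
      using X by (simp add: ring_generators_def cartier_G_def)
    have "gen (degree_le R D 0 \<union> (X \<union> ?Y)) = gen (degree_le R D (int (Suc e)))"
    proof
      have "X \<subseteq> gen (degree_le R D 0 \<union> X)" by (auto intro: generate_ring.incl)
      also have "\<dots> \<subseteq> gen (degree_le R D (int (Suc e)))"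
        unfolding GX by (intro generate_ring_mono degree_le_mono) simp
      finally have "X \<subseteq> gen (degree_le R D (int (Suc e)))" .
      moreover have "?Y \<subseteq> degree_le R D (int (Suc e))"
        using YD by (auto simp: degree_le_def homog_def)
      moreover have "degree_le R D 0 \<subseteq> degree_le R D (int (Suc e))"
        by (intro degree_le_mono) simp
      ultimately show "gen (degree_le R D 0 \<union> (X \<union> ?Y)) \<subseteq> gen (degree_le R D (int (Suc e)))"
        by (intro generate_ring_subsetI) (auto intro: generate_ring.incl)
      have "degree_le R D (int e) \<subseteq> gen (degree_le R D 0 \<union> X)"
        unfolding GX by (auto intro: generate_ring.incl)
      also have "\<dots> \<subseteq> gen (degree_le R D 0 \<union> (X \<union> ?Y))" by (intro generate_ring_mono) auto
      finally have "degree_le R D (int (Suc e)) \<subseteq> gen (degree_le R D 0 \<union> (X \<union> ?Y))"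
        using gen generate_ring_mono[of "degree_le R D 0 \<union> ?Y" "degree_le R D 0 \<union> (X \<union> ?Y)" CA]
        by (intro degree_le_Suc_subset) auto
      then show "gen (degree_le R D (int (Suc e))) \<subseteq> gen (degree_le R D 0 \<union> (X \<union> ?Y))"
        by (rule generate_ring_subsetI)
    qed
    then show "gen (degree_le R D 0 \<union> (X \<union> ?Y)) = cartier_G p R D (int (Suc e))"
      by (simp add: cartier_G_def)
  qed
  from k_le[OF this] have "k (int (Suc e)) \<le> enat (card (X \<union> ?Y))" .
  also have "\<dots> \<le> enat (card X + card Y)"
    using card_Un_le[of X ?Y] card_image_le[OF Y(1), of "homog R (Suc e)"] by simp
  finally show ?thesis .
qed

text \<open>From an optimal system for \<open>Suc e\<close> keep the generators living in degrees up
  to \<open>e\<close>. By \<open>homog_component_in_generate_ring\<close> the discarded ones cannot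
  affect components up to \<open>e\<close>, so the kept ones generate the smaller subring.\<close>

lemma k_mono_Suc:
  assumes "k (int (Suc e)) \<noteq> \<infinity>"
  shows "k (int e) \<le> k (int (Suc e))"
proof -
  obtain X where X: "ring_generators (int (Suc e)) X" and kX: "k (int (Suc e)) = enat (card X)"
    using k_attained[OF assms] .
  have XD: "X \<subseteq> D" using ring_generators_subset[OF X] by simp
  \<comment> \<open>The selection is by vanishing of high components, since the zero element is
    homogeneous of every degree.\<close>
  define X' where "X' = {\<Phi>\<in>X. \<forall>i>e. \<Phi> i = zero_map R}"
  have X'D: "degree_le R D 0 \<union> X' \<subseteq> D" using XD degree_le_subset by (auto simp: X'_def)
  have comp: "homog R i (\<Phi> i) \<in> gen (degree_le R D 0 \<union> X')"
    if "\<Phi> \<in> degree_le R D 0 \<union> X" "i \<le> e" for \<Phi> i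
  proof (cases "\<Phi> \<in> degree_le R D 0")
    case True
    then have "homog R i (\<Phi> i) \<in> degree_le R D 0"
      using homog_component_in_D[of \<Phi> i] by (auto simp: degree_le_def homog_def)
    then show ?thesis by (auto intro: generate_ring.incl)
  next
    case False
    with that have "\<Phi> \<in> X" by auto
    with X obtain j \<phi> where \<Phi>: "\<Phi> = homog R j \<phi>"
      by (auto simp: ring_generators_def homogeneous_def)
    show ?thesis
    proof (cases "j = i")
      case True
      with \<Phi> \<open>\<Phi> \<in> X\<close> \<open>i \<le> e\<close> have "\<Phi> \<in> X'" by (auto simp: X'_def homog_def)
      moreover have "homog R i (\<Phi> i) = \<Phi>" using \<Phi> True by (auto simp: homog_def)
      ultimately show ?thesis by (auto intro: generate_ring.incl)
    next
      case False
      then have "\<Phi> i = zero_map R" using \<Phi> by (auto simp: homog_def)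
      then show ?thesis by (simp add: homog_zero_map_in_generate_ring)
    qed
  qed
  have "ring_generators (int e) X'"
    unfolding ring_generators_def
  proof (intro conjI)
    show "finite X'" "X' \<subseteq> homogeneous p R" using X by (auto simp: ring_generators_def X'_def)
    have "degree_le R D (int e) \<subseteq> gen (degree_le R D 0 \<union> X')"
    proof
      fix \<Phi> assume \<Phi>: "\<Phi> \<in> degree_le R D (int e)"
      then have "\<Phi> \<in> gen (degree_le R D (int (Suc e)))"
        using degree_le_mono[of "int e" "int (Suc e)"] by (auto intro: generate_ring.incl)
      also have "\<dots> = gen (degree_le R D 0 \<union> X)"
        using X by (simp add: ring_generators_def cartier_G_def)
      finally have *: "homog R i (\<Phi> i) \<in> gen (degree_le R D 0 \<union> X')" if "i \<le> e" for i
        using homog_component_in_generate_ring[where H = "degree_le R D 0 \<union> X" and m = e, OF _ X'D]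
          comp that XD degree_le_subset by blast
      have "\<Phi> \<in> D" "\<And>i. i > e \<Longrightarrow> \<Phi> i = zero_map R"
        using \<Phi> by (simp_all add: degree_le_def)
      then show "\<Phi> \<in> gen (degree_le R D 0 \<union> X')"
        using * by (intro generate_ring_of_components[of \<Phi> e])
    qed
    then have "gen (degree_le R D (int e)) \<subseteq> gen (degree_le R D 0 \<union> X')"
      by (rule generate_ring_subsetI)
    moreover have "degree_le R D 0 \<union> X' \<subseteq> degree_le R D (int e)"
    proof (rule Un_least)
      show "degree_le R D 0 \<subseteq> degree_le R D (int e)" by (rule degree_le_mono) simp
      show "X' \<subseteq> degree_le R D (int e)"
        unfolding X'_def degree_le_def using XD by auto
    qed
    then have "gen (degree_le R D 0 \<union> X') \<subseteq> gen (degree_le R D (int e))"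
      by (rule generate_ring_mono)
    ultimately show "gen (degree_le R D 0 \<union> X') = cartier_G p R D (int e)"
      by (simp add: cartier_G_def)
  qed
  from k_le[OF this] have "k (int e) \<le> enat (card X')" .
  also have "\<dots> \<le> enat (card X)"
    using X by (auto simp: X'_def ring_generators_def intro: card_mono)
  finally show ?thesis using kX by simp
qed

text \<open>If the new graded piece is already generated, the subring does not grow, and
  \<open>cartier_k\<close> depends on the degree only through that subring.\<close>

lemma k_Suc_eq:
  assumes "\<And>\<phi>. \<phi> \<in> graded_piece D (Suc e) \<Longrightarrow> homog R (Suc e) \<phi> \<in> gen (degree_le R D (int e))"
  shows "k (int (Suc e)) = k (int e)"
proof -
  have "degree_le R D (int (Suc e)) \<subseteq> gen (degree_le R D (int e))"
    using assms by (intro degree_le_Suc_subset) (auto intro: generate_ring.incl)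
  then have "gen (degree_le R D (int (Suc e))) = gen (degree_le R D (int e))"
    by (intro subset_antisym generate_ring_subsetI[of "degree_le R D (int (Suc e))"]
        generate_ring_mono degree_le_mono) simp_all
  then show ?thesis by (simp add: cartier_k_def cartier_G_def)
qed

end

section \<open>Fedder's isomorphism\<close>

lemma (in ideal) quotient_cases:
  assumes "Y \<in> carrier (R Quot I)"
  obtains s where "s \<in> carrier R" "Y = I +> s"
proof -
  have "Y \<in> a_rcosets I" using assms by (simp only: FactRing_def partial_object.simps)
  with that show thesis unfolding A_RCOSETS_def' by blast
qed

text \<open>An abstraction from polynomials: \<open>K\<close> stands for \<open>\<kappa> e\<close>,
  and \<open>u\<close>, \<open>v\<close> for dual bases with respect to \<open>K\<close>. Only the
  expansion of each \<open>s\<close> is demanded, not uniqueness of its coordinates.\<close>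

locale fedder = cring R + ideal I R for R (structure) and I +
  fixes p e :: nat and K and J :: "'j set" and u v
  assumes K: "K \<in> cartier_maps p R e"
    and finite_J: "finite J"
    and u: "\<And>j. j \<in> J \<Longrightarrow> u j \<in> carrier R"
    and v: "\<And>j. j \<in> J \<Longrightarrow> v j \<in> carrier R"
    and basis: "\<And>s. s \<in> carrier R \<Longrightarrow> s = (\<Oplus>j\<in>J. (K (v j \<otimes> s) [^] (p ^ e)) \<otimes> u j)"
begin

section \<open>Multipliers and the maps they induce on the quotient\<close>

abbreviation "RI \<equiv> R Quot I"
abbreviation "Q \<equiv> frobenius_power R I (p ^ e)"

definition stab where
  "stab = {f \<in> carrier R. \<forall>a\<in>I. K (f \<otimes> a) \<in> I}"

definition null where
  "null = {f \<in> carrier R. \<forall>s\<in>carrier R. K (f \<otimes> s) \<in> I}"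

definition induced where
  "induced f = (\<lambda>Y\<in>carrier RI. \<Union>s\<in>Y. I +> K (f \<otimes> s))"

sublocale \<pi>: ring_hom_cring R RI "(+>) I"
  by (rule rcos_ring_hom_cring) (rule cring_axioms)

lemma K_closed [simp]: "s \<in> carrier R \<Longrightarrow> K s \<in> carrier R"
  by (rule cartier_maps_closed[OF K])

lemma K_add: "r \<in> carrier R \<Longrightarrow> s \<in> carrier R \<Longrightarrow> K (r \<oplus> s) = K r \<oplus> K s"
  by (rule cartier_maps_add[OF K])

lemma K_uminus:
  assumes "s \<in> carrier R"
  shows "K (\<ominus> s) = \<ominus> K s"
proof -
  have "K (\<ominus> s) \<oplus> K s = \<zero>"
    using assms by (simp add: K_add[symmetric] l_neg cartier_maps_zero[OF K])
  then show ?thesis using assms by (simp add: minus_equality)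
qed

lemma K_pow: "r \<in> carrier R \<Longrightarrow> s \<in> carrier R \<Longrightarrow> K ((r [^] (p ^ e)) \<otimes> s) = r \<otimes> K s"
  by (rule cartier_maps_pow[OF K])

lemma coset_closed: "s \<in> carrier R \<Longrightarrow> I +> s \<in> carrier RI"
  by (rule \<pi>.hom_closed)

lemma coset_eq_zero_iff: "s \<in> carrier R \<Longrightarrow> I +> s = \<zero>\<^bsub>RI\<^esub> \<longleftrightarrow> s \<in> I"
  by (metis FactRing_def a_rcos_const a_rcos_self ring.simps(1))

lemma in_cosetE:
  assumes "x \<in> M +> s"
  obtains i where "i \<in> M" "x = i \<oplus> s"
  using assms by (auto simp: a_r_coset_def r_coset_def)

lemma coset_add_I:
  assumes "i \<in> I" "s \<in> carrier R"
  shows "I +> (i \<oplus> s) = I +> s"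
  using assms coset_eq_zero_iff[of i] by (simp add: coset_closed)

lemma stab_closed: "f \<in> stab \<Longrightarrow> f \<in> carrier R"
  by (simp add: stab_def)

text \<open>Changing \<open>s\<close> by \<open>i \<in> I\<close> changes
  \<open>K (f \<otimes> s)\<close> by \<open>K (f \<otimes> i)\<close>, which lies in
  \<open>I\<close> because \<open>f \<in> stab\<close>; so the union defining \<open>induced\<close>
  is one of equal cosets.\<close>

lemma induced_coset:
  assumes "f \<in> stab" "s \<in> carrier R"
  shows "induced f (I +> s) = I +> K (f \<otimes> s)"
proof -
  have "I +> K (f \<otimes> s') = I +> K (f \<otimes> s)" if "s' \<in> I +> s" for s'
  proof -
    from that obtain i where i: "i \<in> I" "s' = i \<oplus> s" by (rule in_cosetE)
    then have "K (f \<otimes> s') = K (f \<otimes> i) \<oplus> K (f \<otimes> s)"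
      using assms stab_closed by (simp add: r_distr K_add)
    moreover have "K (f \<otimes> i) \<in> I" using i assms by (simp add: stab_def)
    ultimately show ?thesis using assms stab_closed by (simp add: coset_add_I del: \<pi>.hom_add)
  qed
  moreover have "s \<in> I +> s" using assms by (simp add: a_rcos_self)
  ultimately have "(\<Union>s'\<in>I +> s. I +> K (f \<otimes> s')) = I +> K (f \<otimes> s)" by blast
  then show ?thesis using coset_closed[OF assms(2)] by (simp add: induced_def)
qed

lemma extensional_RI_eqI:
  assumes "\<phi> \<in> extensional (carrier RI)" "\<psi> \<in> extensional (carrier RI)"
    and "\<And>s. s \<in> carrier R \<Longrightarrow> \<phi> (I +> s) = \<psi> (I +> s)"
  shows "\<phi> = \<psi>"
proof (rule extensionalityI[OF assms(1,2)])
  fix Y assume "Y \<in> carrier RI"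
  then obtain s where "s \<in> carrier R" "Y = I +> s" by (rule quotient_cases)
  then show "\<phi> Y = \<psi> Y" by (simp add: assms(3))
qed

lemma induced_extensional: "induced f \<in> extensional (carrier RI)"
  by (simp add: induced_def)

lemma ideal_null: "ideal null R"
proof (rule idealI[OF ring_axioms])
  show "subgroup null (add_monoid R)"
  proof
    show "null \<subseteq> carrier (add_monoid R)" by (auto simp: null_def)
    show "\<one>\<^bsub>add_monoid R\<^esub> \<in> null" by (simp add: null_def cartier_maps_zero[OF K])
    show "x \<otimes>\<^bsub>add_monoid R\<^esub> y \<in> null" if "x \<in> null" "y \<in> null" for x y
      using that by (simp add: null_def l_distr K_add)
    show "inv\<^bsub>add_monoid R\<^esub> x \<in> null" if "x \<in> null" for x
    proof -
      have "\<ominus> x \<in> null" using that by (simp add: null_def l_minus K_uminus)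
      then show ?thesis by (simp add: a_inv_def)
    qed
  qed
  show "x \<otimes> a \<in> null" and "a \<otimes> x \<in> null" if "x \<in> null" "a \<in> carrier R" for x a
  proof -
    show "x \<otimes> a \<in> null" using that by (simp add: null_def m_assoc)
    then show "a \<otimes> x \<in> null" using that m_comm[of a x] by (simp add: null_def)
  qed
qed

lemma ideal_Q: "ideal Q R"
  unfolding frobenius_power_def by (rule genideal_ideal) auto

lemma pow_in_Q: "a \<in> I \<Longrightarrow> a [^] (p ^ e) \<in> Q"
  unfolding frobenius_power_def by (rule genideal_self[THEN subsetD]) auto

text \<open>The power of \<open>a \<in> I\<close> passes through \<open>K\<close> as the factor
  \<open>a\<close>, so the generators of \<open>Q\<close> lie in the ideal \<open>null\<close>.
  Hence cosets of \<open>Q\<close> have well-defined induced maps.\<close>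

lemma Q_subset_null: "Q \<subseteq> null"
proof -
  have "(\<lambda>f. f [^] (p ^ e)) ` I \<subseteq> null"
    by (auto simp: null_def K_pow I_r_closed)
  then show ?thesis
    unfolding frobenius_power_def by (rule genideal_minimal[OF ideal_null])
qed

lemma null_subset_stab: "null \<subseteq> stab"
  by (auto simp: null_def stab_def)

lemma stab_add: "f \<in> stab \<Longrightarrow> g \<in> stab \<Longrightarrow> f \<oplus> g \<in> stab"
  by (simp add: stab_def l_distr K_add)

lemma stab_uminus: "f \<in> stab \<Longrightarrow> \<ominus> f \<in> stab"
  by (simp add: stab_def l_minus K_uminus)

lemma stab_mult: "f \<in> stab \<Longrightarrow> r \<in> carrier R \<Longrightarrow> f \<otimes> r \<in> stab"
  by (simp add: stab_def m_assoc I_l_closed)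

lemma induced_add:
  assumes "f \<in> stab" "g \<in> stab"
  shows "induced (f \<oplus> g) = (\<lambda>Y\<in>carrier RI. induced f Y \<oplus>\<^bsub>RI\<^esub> induced g Y)"
  using assms
  by (intro extensional_RI_eqI induced_extensional)
     (simp_all add: induced_coset stab_add stab_closed l_distr K_add coset_closed)

lemma induced_uminus:
  assumes "f \<in> stab"
  shows "induced (\<ominus> f) = (\<lambda>Y\<in>carrier RI. \<ominus>\<^bsub>RI\<^esub> induced f Y)"
  using assms
  by (intro extensional_RI_eqI induced_extensional)
     (simp_all add: induced_coset stab_uminus stab_closed l_minus K_uminus coset_closed)

text \<open>The inner map is a degree-zero Cartier map, so the right-hand side is a product of the
  shape in \<open>homog_mult\<close>. Multiplying \<open>f\<close> by \<open>r\<close> thus becomes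
  right multiplication inside the Cartier algebra.\<close>

lemma induced_mult:
  assumes "f \<in> stab" "r \<in> carrier R"
  shows "induced (f \<otimes> r)
    = (\<lambda>Y\<in>carrier RI. induced f ((\<lambda>Z\<in>carrier RI. (I +> r) \<otimes>\<^bsub>RI\<^esub> Z) Y))"
proof (rule extensional_RI_eqI)
  fix s assume s: "s \<in> carrier R"
  have "(I +> r) \<otimes>\<^bsub>RI\<^esub> (I +> s) = I +> (r \<otimes> s)"
    using s assms by simp
  with s assms show "induced (f \<otimes> r) (I +> s)
      = (\<lambda>Y\<in>carrier RI. induced f ((\<lambda>Z\<in>carrier RI. (I +> r) \<otimes>\<^bsub>RI\<^esub> Z) Y)) (I +> s)"
    by (simp add: coset_closed induced_coset stab_mult stab_closed m_assoc del: \<pi>.hom_mult)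
qed (simp_all add: induced_extensional)

lemma induced_null:
  assumes "f \<in> null"
  shows "induced f = zero_map RI"
proof -
  have f: "f \<in> stab" using assms null_subset_stab by auto
  show ?thesis
  proof (rule extensional_RI_eqI[OF induced_extensional])
    fix s assume s: "s \<in> carrier R"
    have "I +> K (f \<otimes> s) = \<zero>\<^bsub>RI\<^esub>"
      using assms f s by (subst coset_eq_zero_iff) (simp_all add: null_def)
    then show "induced f (I +> s) = zero_map RI (I +> s)"
      using f s by (simp add: zero_map_def induced_coset coset_closed)
  qed (simp add: zero_map_def)
qed

text \<open>The coordinates of \<open>s\<close> with respect to \<open>u\<close> are \<open>K (v j \<otimes> s)\<close>, so a map on the quotient
  is determined by lifts \<open>r j\<close> of its values on the cosets of \<open>u j\<close>.\<close>

lemma induced_surj: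
  assumes \<phi>: "\<phi> \<in> cartier_maps p RI e"
  obtains f where "f \<in> stab" "induced f = \<phi>"
proof -
  have "\<exists>r. r \<in> carrier R \<and> \<phi> (I +> u j) = I +> r" if "j \<in> J" for j
    using \<pi>.S.cartier_maps_closed[OF \<phi> coset_closed[OF u[OF that]]] by (auto elim: quotient_cases)
  then obtain r where r: "\<And>j. j \<in> J \<Longrightarrow> r j \<in> carrier R"
    and \<phi>_u: "\<And>j. j \<in> J \<Longrightarrow> \<phi> (I +> u j) = I +> r j" by metis
  \<comment> \<open>The powers of \<open>r j\<close> leave \<open>K\<close> as plain factors, so
    \<open>K (f \<otimes> s)\<close> combines the coordinates of \<open>s\<close> with the values
    \<open>r j\<close>.\<close>
  define f where "f = (\<Oplus>j\<in>J. (r j [^] (p ^ e)) \<otimes> v j)"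
  have f: "f \<in> carrier R" using r v by (auto simp: f_def intro!: finsum_closed)
  have K_f: "K (f \<otimes> s) = (\<Oplus>j\<in>J. r j \<otimes> K (v j \<otimes> s))" if s: "s \<in> carrier R" for s
  proof -
    have "f \<otimes> s = (\<Oplus>j\<in>J. ((r j [^] (p ^ e)) \<otimes> v j) \<otimes> s)"
      unfolding f_def using r v s finite_J by (intro finsum_ldistr) auto
    also have "K \<dots> = (\<Oplus>j\<in>J. K (((r j [^] (p ^ e)) \<otimes> v j) \<otimes> s))"
      using r v s by (intro cartier_maps_finsum[OF K finite_J]) auto
    also have "\<dots> = (\<Oplus>j\<in>J. r j \<otimes> K (v j \<otimes> s))"
      using r v s by (intro finsum_cong') (auto simp: m_assoc K_pow)
    finally show ?thesis .
  qed
  have \<phi>_K: "\<phi> (I +> s) = I +> K (f \<otimes> s)" if s: "s \<in> carrier R" for s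
  proof -
    let ?c = "\<lambda>j. K (v j \<otimes> s)"
    have c: "?c j \<in> carrier R" if "j \<in> J" for j using that s v by auto
    have "I +> s = I +> (\<Oplus>j\<in>J. (?c j [^] (p ^ e)) \<otimes> u j)"
      using basis[OF s] by simp
    also have "\<dots> = (\<Oplus>\<^bsub>RI\<^esub>j\<in>J. I +> ((?c j [^] (p ^ e)) \<otimes> u j))"
      using c u by (subst \<pi>.hom_finsum) (auto simp: o_def)
    also have "\<phi> \<dots> = (\<Oplus>\<^bsub>RI\<^esub>j\<in>J. \<phi> (I +> ((?c j [^] (p ^ e)) \<otimes> u j)))"
      using c u by (intro \<pi>.S.cartier_maps_finsum[OF \<phi> finite_J]) (auto intro!: coset_closed)
    also have "\<dots> = (\<Oplus>\<^bsub>RI\<^esub>j\<in>J. I +> (r j \<otimes> ?c j))"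
    proof (rule \<pi>.S.finsum_cong')
      fix j assume j: "j \<in> J"
      have "I +> ((?c j [^] (p ^ e)) \<otimes> u j)
          = ((I +> ?c j) [^]\<^bsub>RI\<^esub> (p ^ e)) \<otimes>\<^bsub>RI\<^esub> (I +> u j)"
        using c u j by simp
      then have "\<phi> (I +> ((?c j [^] (p ^ e)) \<otimes> u j)) = (I +> ?c j) \<otimes>\<^bsub>RI\<^esub> (I +> r j)"
        using c u j \<phi>_u by (simp add: \<pi>.S.cartier_maps_pow[OF \<phi>] coset_closed del: \<pi>.hom_mult)
      then show "\<phi> (I +> ((?c j [^] (p ^ e)) \<otimes> u j)) = I +> (r j \<otimes> ?c j)"
        using c r j by (simp add: \<pi>.S.m_comm coset_closed)
    qed (use r c in \<open>auto intro!: coset_closed\<close>)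
    also have "\<dots> = I +> (\<Oplus>j\<in>J. r j \<otimes> ?c j)"
      using r c by (subst \<pi>.hom_finsum) (auto simp: o_def)
    finally show ?thesis using K_f[OF s] by simp
  qed
  \<comment> \<open>Elements of \<open>I\<close> represent zero and \<open>\<phi>\<close> preserves
    zero, so stability can be read off from \<open>\<phi>_K\<close>.\<close>
  have "f \<in> stab"
    unfolding stab_def
  proof (intro CollectI conjI ballI f)
    fix a assume a: "a \<in> I"
    then have "I +> K (f \<otimes> a) = \<phi> \<zero>\<^bsub>RI\<^esub>"
      using \<phi>_K[of a] coset_eq_zero_iff[of a] by simp
    then have "I +> K (f \<otimes> a) = \<zero>\<^bsub>RI\<^esub>" by (simp add: \<pi>.S.cartier_maps_zero[OF \<phi>])
    then show "K (f \<otimes> a) \<in> I" using a f by (simp add: coset_eq_zero_iff)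
  qed
  moreover have "induced f = \<phi>"
    using \<pi>.S.cartier_maps_extensional[OF \<phi>] \<open>f \<in> stab\<close>
    by (intro extensional_RI_eqI induced_extensional) (simp_all add: induced_coset \<phi>_K)
  ultimately show thesis by (rule that)
qed

section \<open>Colon ideal and Fedder's map\<close>

lemma finsum_in_ideal:
  assumes "ideal M R" "finite F" "\<And>j. j \<in> F \<Longrightarrow> g j \<in> M"
  shows "(\<Oplus>j\<in>F. g j) \<in> M"
proof -
  interpret M: ideal M R by fact
  from assms(2,3) show ?thesis
  proof (induction F rule: finite_induct)
    case (insert j F)
    have g: "g i \<in> M" if "i \<in> insert j F" for i using insert.prems that .
    have "(\<Oplus>i\<in>insert j F. g i) = g j \<oplus> (\<Oplus>i\<in>F. g i)"
      using insert.hyps g by (intro finsum_insert Pi_I M.Icarr) simp_all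
    then show ?case
      using insert.IH g by (simp add: M.a_closed)
  qed simp
qed

text \<open>If \<open>f \<in> stab\<close> and \<open>a \<in> I\<close>, all coordinates of
  \<open>f \<otimes> a\<close> lie in \<open>I\<close>, so its expansion is a combination of
  generators of \<open>Q\<close>. Conversely \<open>f \<otimes> a \<in> Q\<close> lies in
  \<open>null\<close>, whose condition is evaluated at \<open>\<one>\<close>.\<close>

lemma stab_eq_colon_ideal: "stab = colon_ideal R Q I"
proof
  interpret Q: ideal Q R by (rule ideal_Q)
  show "stab \<subseteq> colon_ideal R Q I"
  proof
    fix f assume f: "f \<in> stab"
    have "f \<otimes> a \<in> Q" if a: "a \<in> I" for a
    proof -
      have "K (v j \<otimes> (f \<otimes> a)) \<in> I" if "j \<in> J" for j
      proof -
        have "v j \<otimes> (f \<otimes> a) = f \<otimes> (v j \<otimes> a)"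
          using that a v f by (simp add: stab_closed m_lcomm)
        then show ?thesis using that a v f by (simp add: stab_def I_l_closed)
      qed
      then have "(\<Oplus>j\<in>J. (K (v j \<otimes> (f \<otimes> a)) [^] (p ^ e)) \<otimes> u j) \<in> Q"
        using u by (intro finsum_in_ideal[OF ideal_Q finite_J] Q.I_r_closed pow_in_Q)
      then show ?thesis using basis[of "f \<otimes> a"] a f by (simp add: stab_closed)
    qed
    then show "f \<in> colon_ideal R Q I" using f by (simp add: colon_ideal_def stab_closed)
  qed
  show "colon_ideal R Q I \<subseteq> stab"
  proof
    fix f assume f: "f \<in> colon_ideal R Q I"
    have "K (f \<otimes> a) \<in> I" if "a \<in> I" for a
    proof -
      have "f \<otimes> a \<in> null" using f that Q_subset_null by (auto simp: colon_ideal_def)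
      then have "K (f \<otimes> a \<otimes> \<one>) \<in> I" unfolding null_def by blast
      then show ?thesis using f that by (simp add: colon_ideal_def)
    qed
    then show "f \<in> stab" using f by (simp add: colon_ideal_def stab_def)
  qed
qed

text \<open>Two representatives of a coset of \<open>Q\<close> differ by an element of
  \<open>null\<close>, which induces the zero map.\<close>

lemma fedder_map_eq_induced:
  assumes f: "f \<in> stab"
  shows "fedder_map R I K (Q +> f) = induced f"
proof -
  interpret Q: ideal Q R by (rule ideal_Q)
  have *: "(\<Union>s\<in>Y. I +> K (g \<otimes> s)) = induced f Y"
    if "g \<in> Q +> f" "Y \<in> carrier RI" for g Y
  proof -
    from that(1) obtain x where x: "x \<in> Q" "g = x \<oplus> f" by (rule in_cosetE)
    have xn: "x \<in> null" using x Q_subset_null by auto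
    then have xs: "x \<in> stab" using null_subset_stab by auto
    from that(2) obtain s where s: "s \<in> carrier R" "Y = I +> s" by (rule quotient_cases)
    have "induced g Y = induced f Y"
      using x xs f s xn \<pi>.S.l_zero
      by (simp add: stab_add induced_coset induced_add induced_null coset_closed zero_map_def stab_closed)
    then show ?thesis using that(2) by (simp add: induced_def)
  qed
  have "f \<in> Q +> f" using f by (simp add: Q.a_rcos_self stab_closed)
  then show ?thesis
    using * induced_extensional[of f]
    by (auto simp: fedder_map_def fun_eq_iff extensional_def)
qed

lemma fedder_domain_eq: "fedder_domain R I (p ^ e) = (\<lambda>f. Q +> f) ` stab"
  by (simp only: fedder_domain_def Let_def stab_eq_colon_ideal)

lemma Q_coset_stab:
  assumes "f \<in> carrier R" "g \<in> stab" "Q +> f = Q +> g"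
  obtains x where "x \<in> Q" "f = x \<oplus> g"
proof -
  interpret Q: ideal Q R by (rule ideal_Q)
  have "f \<in> Q +> g" using assms Q.a_rcos_self by blast
  then show thesis using that by (rule in_cosetE)
qed

text \<open>Since \<open>Q\<close> lies in \<open>stab\<close>, membership of a coset can be tested
  on any representative, in particular on a chosen generator.\<close>

lemma coset_in_fedder_preimage_iff:
  assumes "\<kappa> e = K" "f \<in> carrier R"
  shows "Q +> f \<in> fedder_preimage p R I \<kappa> D e \<longleftrightarrow> f \<in> stab \<and> induced f \<in> graded_piece D e"
proof
  assume L: "Q +> f \<in> fedder_preimage p R I \<kappa> D e"
  then have "Q +> f \<in> (\<lambda>f. Q +> f) ` stab"
    by (simp only: fedder_preimage_def fedder_domain_eq mem_Collect_eq)
  then obtain g where g: "g \<in> stab" "Q +> f = Q +> g" by blast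
  then obtain x where "x \<in> Q" "f = x \<oplus> g" using Q_coset_stab assms(2) by blast
  then have f: "f \<in> stab" using g Q_subset_null null_subset_stab stab_add by blast
  from L have "fedder_map R I K (Q +> f) \<in> graded_piece D e"
    by (simp only: fedder_preimage_def mem_Collect_eq assms(1))
  with f show "f \<in> stab \<and> induced f \<in> graded_piece D e"
    by (simp only: fedder_map_eq_induced simp_thms)
next
  assume f: "f \<in> stab \<and> induced f \<in> graded_piece D e"
  then have "Q +> f \<in> (\<lambda>f. Q +> f) ` stab" by blast
  with f show "Q +> f \<in> fedder_preimage p R I \<kappa> D e"
    by (simp only: fedder_preimage_def fedder_map_eq_induced fedder_domain_eq mem_Collect_eq
        assms(1) simp_thms)
qed

text \<open>Pulling a generated subring back along Fedder's map gives an ideal: scalars act by right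
  multiplication with degree-zero elements, and these are in the subring by assumption. Membership
  then has to be checked on ideal generators only.\<close>

lemma ideal_of_generate_ring:
  assumes "cartier_sub RI p D" "H \<subseteq> D"
    and 0: "degree_le RI D 0 \<subseteq> generate_ring (cartier_algebra p RI) H"
  shows "ideal {f \<in> stab. homog RI e (induced f) \<in> generate_ring (cartier_algebra p RI) H} R"
    (is "ideal ?M R")
proof -
  interpret D: cartier_sub RI p D by fact
  let ?G = "generate_ring (cartier_algebra p RI) H"
  have GD: "?G \<subseteq> D" by (rule D.generate_subset_D) fact
  show ?thesis
  proof (rule idealI[OF ring_axioms])
    show "subgroup ?M (add_monoid R)"
    proof
      show "?M \<subseteq> carrier (add_monoid R)" by (auto simp: stab_closed)
      have z: "\<zero> \<in> null" by (simp add: null_def cartier_maps_zero[OF K])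
      then have "\<zero> \<in> stab" using null_subset_stab by auto
      then show "\<one>\<^bsub>add_monoid R\<^esub> \<in> ?M"
        using induced_null[OF z] by (simp add: D.homog_zero_map_in_generate_ring)
      show "f \<otimes>\<^bsub>add_monoid R\<^esub> g \<in> ?M" if "f \<in> ?M" "g \<in> ?M" for f g
      proof -
        have "homog RI e (induced f) \<oplus>\<^bsub>cartier_algebra p RI\<^esub> homog RI e (induced g) \<in> ?G"
          using that by (intro generate_ring.eng_add) auto
        with that show ?thesis by (simp add: stab_add induced_add \<pi>.S.homog_add)
      qed
      show "inv\<^bsub>add_monoid R\<^esub> f \<in> ?M" if "f \<in> ?M" for f
      proof -
        have "\<ominus>\<^bsub>cartier_algebra p RI\<^esub> homog RI e (induced f) \<in> ?G"
          using that by (intro generate_ring.a_inv) auto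
        moreover have "homog RI e (induced f) \<in> carrier (cartier_algebra p RI)"
          using that GD D.D_closed(1) by auto
        ultimately have "\<ominus> f \<in> ?M"
          using that by (simp add: stab_uminus induced_uminus \<pi>.S.homog_a_inv)
        then show ?thesis by (simp add: a_inv_def)
      qed
    qed
    show r: "f \<otimes> r \<in> ?M" and "r \<otimes> f \<in> ?M" if f: "f \<in> ?M" and r: "r \<in> carrier R" for f r
    proof -
      let ?m = "\<lambda>Z\<in>carrier RI. (I +> r) \<otimes>\<^bsub>RI\<^esub> Z"
      have m: "?m \<in> cartier_maps p RI 0"
        using coset_closed[OF r] by (rule \<pi>.S.mult_in_cartier_maps_0)
      have "homog RI e (induced f) \<in> D" using f GD by auto
      then have i: "induced f \<in> cartier_maps p RI e"
        using D.D_component[of "homog RI e (induced f)" e] by (simp add: homog_def)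
      have "homog RI e (induced f) \<otimes>\<^bsub>cartier_algebra p RI\<^esub> homog RI 0 ?m \<in> ?G"
        using f 0 D.homog_0_in_degree_le[OF m] by (intro generate_ring.eng_mult) auto
      then have "homog RI e (induced (f \<otimes> r)) \<in> ?G"
        using f r \<pi>.S.homog_mult[OF i m] induced_mult[of f r] by simp
      then show "f \<otimes> r \<in> ?M" using f r by (auto intro: stab_mult)
      then show "r \<otimes> f \<in> ?M" using f r by (simp add: m_comm stab_closed)
    qed
  qed
qed

text \<open>Ideal generators of \<open>J\<^sub>e\<close> become ring generators of the graded piece:
  \<open>?M\<close> is an ideal containing \<open>A\<close>, so its image contains all of
  \<open>J\<^sub>e\<close>, and \<open>induced_surj\<close> reaches every \<open>\<phi>\<close> from
  there.\<close>

lemma graded_piece_subset_generate_ring: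
  assumes D: "cartier_sub RI p D" "H \<subseteq> D"
    and 0: "degree_le RI D 0 \<subseteq> generate_ring (cartier_algebra p RI) H"
    and \<kappa>: "\<kappa> e = K"
    and A: "A \<subseteq> carrier R" "genideal (R Quot Q) ((\<lambda>f. Q +> f) ` A) = fedder_preimage p R I \<kappa> D e"
    and gen: "\<And>f. f \<in> A \<Longrightarrow> f \<in> stab \<Longrightarrow> induced f \<in> graded_piece D e \<Longrightarrow>
      homog RI e (induced f) \<in> generate_ring (cartier_algebra p RI) H"
    and \<phi>: "\<phi> \<in> graded_piece D e"
  shows "homog RI e \<phi> \<in> generate_ring (cartier_algebra p RI) H"
proof -
  interpret D: cartier_sub RI p D by fact
  interpret Q: ideal Q R by (rule ideal_Q)
  interpret RQ: ring "R Quot Q" by (rule Q.quotient_is_ring)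
  let ?M = "{f \<in> stab. homog RI e (induced f) \<in> generate_ring (cartier_algebra p RI) H}"
  have M: "ideal ?M R" by (rule ideal_of_generate_ring[OF D 0])
  have AJ: "(\<lambda>f. Q +> f) ` A \<subseteq> fedder_preimage p R I \<kappa> D e"
    unfolding A(2)[symmetric] using A(1)
    using ring_hom_closed[OF Q.rcos_ring_hom] by (intro RQ.genideal_self) blast
  have "A \<subseteq> ?M"
  proof
    fix f assume f: "f \<in> A"
    with AJ have "Q +> f \<in> fedder_preimage p R I \<kappa> D e" by auto
    with f A(1) coset_in_fedder_preimage_iff[of \<kappa> f D, OF \<kappa>]
    have "f \<in> stab" "induced f \<in> graded_piece D e" by auto
    with f gen show "f \<in> ?M" by auto
  qed
  moreover have "ideal ((\<lambda>f. Q +> f) ` ?M) (R Quot Q)"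
    by (rule ring_ideal_imp_quot_ideal[OF ideal_Q M])
  ultimately have *: "fedder_preimage p R I \<kappa> D e \<subseteq> (\<lambda>f. Q +> f) ` ?M"
    unfolding A(2)[symmetric] by (intro RQ.genideal_minimal image_mono)
  from \<phi> have "\<phi> \<in> cartier_maps p RI e" by (auto simp: graded_piece_def intro: D.D_component)
  then obtain f where f: "f \<in> stab" "induced f = \<phi>" by (rule induced_surj)
  then have "Q +> f \<in> fedder_preimage p R I \<kappa> D e"
    using \<phi> coset_in_fedder_preimage_iff[of \<kappa> f D, OF \<kappa>] by (simp add: stab_closed)
  \<comment> \<open>The lift \<open>f\<close> of \<open>\<phi>\<close> is only known to be congruent
    modulo \<open>Q\<close> to some \<open>g \<in> ?M\<close>; the difference induces zero and so
    lies in \<open>?M\<close> too.\<close>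
  with * obtain g where g: "g \<in> ?M" "Q +> f = Q +> g" by auto
  then obtain x where x: "x \<in> Q" "f = x \<oplus> g"
    using Q_coset_stab stab_closed[OF f(1)] by blast
  have "x \<in> null" "x \<in> stab" using x Q_subset_null null_subset_stab by blast+
  then have "x \<in> ?M"
    by (simp add: induced_null D.homog_zero_map_in_generate_ring)
  then have "f \<in> ?M"
    unfolding x(2) using g(1) by (rule additive_subgroup.a_closed[OF ideal.axioms(1)[OF M]])
  with f show ?thesis by simp
qed

end

section \<open>The Cartier operator on polynomials\<close>

lemma poly_ring_simps [simp]:
  "monoid.mult (poly_ring n) = (*)" "one (poly_ring n) = 1"
  "zero (poly_ring n) = 0" "add (poly_ring n) = (+)"
  by (simp_all add: poly_ring_def)

lemma in_poly_ring_iff: "f \<in> carrier (poly_ring n) \<longleftrightarrow> Poly_Mapping.keys f \<subseteq> exponents n"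
  by (simp add: poly_ring_def)

lemma in_exponents_iff: "\<alpha> \<in> exponents n \<longleftrightarrow> (\<forall>i\<ge>n. Poly_Mapping.lookup \<alpha> i = 0)"
  by (auto simp: exponents_def in_keys_iff subset_iff) (metis leI less_numeral_extra(3))

lemma add_in_exponents: "\<alpha> \<in> exponents n \<Longrightarrow> \<beta> \<in> exponents n \<Longrightarrow> \<alpha> + \<beta> \<in> exponents n"
  by (simp add: in_exponents_iff lookup_add)

lemma single_in_poly_ring: "\<alpha> \<in> exponents n \<Longrightarrow> Poly_Mapping.single \<alpha> c \<in> carrier (poly_ring n)"
  by (simp add: in_poly_ring_iff)

lemma poly_ring_uminus: "f \<in> carrier (poly_ring n) \<Longrightarrow> - f \<in> carrier (poly_ring n)"
  by (auto simp: in_poly_ring_iff in_keys_iff)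

lemma poly_ring_add:
  "f \<in> carrier (poly_ring n) \<Longrightarrow> g \<in> carrier (poly_ring n) \<Longrightarrow> f + g \<in> carrier (poly_ring n)"
  using keys_add[of f g] by (auto simp: in_poly_ring_iff)

lemma poly_ring_mult:
  "f \<in> carrier (poly_ring n) \<Longrightarrow> g \<in> carrier (poly_ring n) \<Longrightarrow> f * g \<in> carrier (poly_ring n)"
  using keys_mult[of f g] add_in_exponents by (fastforce simp: in_poly_ring_iff)

lemma one_in_poly_ring: "1 \<in> carrier (poly_ring n)"
  by (simp add: in_poly_ring_iff in_exponents_iff)

lemma cring_poly_ring: "cring (poly_ring n)"
proof (rule cringI)
  show "abelian_group (poly_ring n)"
  proof (rule abelian_groupI)
    fix f assume "f \<in> carrier (poly_ring n)"
    then show "\<exists>g\<in>carrier (poly_ring n). g \<oplus>\<^bsub>poly_ring n\<^esub> f = \<zero>\<^bsub>poly_ring n\<^esub>"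
      by (intro bexI[of _ "- f"]) (simp_all add: poly_ring_uminus)
  qed (auto simp: poly_ring_add add_ac in_poly_ring_iff[of 0])
  show "Group.comm_monoid (poly_ring n)"
    by (rule comm_monoidI) (auto simp: poly_ring_mult one_in_poly_ring mult_ac)
qed (auto simp: distrib_right)

lemma poly_ring_pow: "f [^]\<^bsub>poly_ring n\<^esub> (m::nat) = f ^ m"
  by (induction m) (simp_all add: nat_pow_def mult_ac)

lemma poly_ring_power: "f \<in> carrier (poly_ring n) \<Longrightarrow> f ^ m \<in> carrier (poly_ring n)"
  by (induction m) (simp_all add: one_in_poly_ring poly_ring_mult)

lemma poly_ring_finsum:
  assumes "finite A" "\<And>x. x \<in> A \<Longrightarrow> f x \<in> carrier (poly_ring n)"
  shows "finsum (poly_ring n) f A = sum f A"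
proof -
  interpret cring "poly_ring n" by (rule cring_poly_ring)
  from assms show ?thesis
    by (induction A rule: finite_induct) (simp_all add: finsum_insert Pi_def)
qed

lemma single_power:
  "Poly_Mapping.single \<alpha> c ^ m = Poly_Mapping.single (\<Sum>i<m. \<alpha>) ((c :: 'k::field) ^ m)"
  for \<alpha> :: "nat \<Rightarrow>\<^sub>0 nat"
  by (induction m) (simp_all add: mult_single add_ac del: sum_constant)

lemma single_sum: "Poly_Mapping.single \<alpha> (\<Sum>j\<in>J. f j) = (\<Sum>j\<in>J. Poly_Mapping.single \<alpha> (f j))"
  by (induction J rule: infinite_finite_induct) (simp_all add: single_add)

lemma sum_of_monomials: "f = (\<Sum>\<alpha>\<in>Poly_Mapping.keys f. Poly_Mapping.single \<alpha> (Poly_Mapping.lookup f \<alpha>))"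
proof (rule poly_mapping_eqI)
  fix \<beta>
  have "(\<Sum>\<alpha>\<in>Poly_Mapping.keys f. Poly_Mapping.lookup (Poly_Mapping.single \<alpha> (Poly_Mapping.lookup f \<alpha>)) \<beta>)
     = (\<Sum>\<alpha>\<in>Poly_Mapping.keys f. if \<alpha> = \<beta> then Poly_Mapping.lookup f \<alpha> else 0)"
    by (intro sum.cong) (auto simp: lookup_single)
  then show "Poly_Mapping.lookup f \<beta> = Poly_Mapping.lookup
      (\<Sum>\<alpha>\<in>Poly_Mapping.keys f. Poly_Mapping.single \<alpha> (Poly_Mapping.lookup f \<alpha>)) \<beta>"
    by (simp add: lookup_sum in_keys_iff)
qed

text \<open>Makes powers with exponent \<open>p ^ e\<close> additive on polynomials as well as on
  coefficients.\<close>

lemma CHAR_mpoly: "CHAR('k::field mpoly) = CHAR('k)"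
proof (rule CHAR_eqI)
  have *: "(of_nat m :: 'k mpoly) = 0 \<longleftrightarrow> (of_nat m :: 'k) = 0" for m
    by (subst single_of_nat[symmetric]) (metis lookup_single_eq lookup_zero single_zero)
  show "of_nat (CHAR('k)) = (0 :: 'k mpoly)" by (subst *) simp
  show "CHAR('k) dvd m" if "of_nat m = (0 :: 'k mpoly)" for m
    using that unfolding * by (simp add: of_nat_eq_0_iff_char_dvd)
qed

section \<open>Exponent vectors modulo q\<close>

definition exp_div :: "nat \<Rightarrow> (nat \<Rightarrow>\<^sub>0 nat) \<Rightarrow> (nat \<Rightarrow>\<^sub>0 nat)" where
  "exp_div q \<alpha> = Poly_Mapping.map (\<lambda>a. a div q) \<alpha>"

definition exp_mod :: "nat \<Rightarrow> (nat \<Rightarrow>\<^sub>0 nat) \<Rightarrow> (nat \<Rightarrow>\<^sub>0 nat)" where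
  "exp_mod q \<alpha> = Poly_Mapping.map (\<lambda>a. a mod q) \<alpha>"

lemma lookup_exp_div [simp]: "Poly_Mapping.lookup (exp_div q \<alpha>) i = Poly_Mapping.lookup \<alpha> i div q"
  by (simp add: exp_div_def Poly_Mapping.map.rep_eq when_def)

lemma lookup_exp_mod [simp]: "Poly_Mapping.lookup (exp_mod q \<alpha>) i = Poly_Mapping.lookup \<alpha> i mod q"
  by (simp add: exp_mod_def Poly_Mapping.map.rep_eq when_def)

text \<open>The multiple of the quotient vector is written as an iterated sum, the form in which
  \<open>single_power\<close> produces exponents.\<close>

lemma exp_div_mod: "(\<Sum>i<q. exp_div q \<alpha>) + exp_mod q \<alpha> = \<alpha>"
proof (rule poly_mapping_eqI)
  fix i
  show "Poly_Mapping.lookup ((\<Sum>i<q. exp_div q \<alpha>) + exp_mod q \<alpha>) i = Poly_Mapping.lookup \<alpha> i"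
    unfolding lookup_add lookup_sum by simp
qed

lemma exp_div_in_exponents: "\<alpha> \<in> exponents n \<Longrightarrow> exp_div q \<alpha> \<in> exponents n"
  by (simp add: in_exponents_iff)

lemma exp_mod_in_exponents: "\<alpha> \<in> exponents n \<Longrightarrow> exp_mod q \<alpha> \<in> exponents n"
  by (simp add: in_exponents_iff)

text \<open>Serves two purposes: with \<open>q = p ^ e\<close> it indexes the monomials of the
  Frobenius basis, and with \<open>q = d + 1\<close> it contains all exponents occurring in degree
  at most \<open>d\<close>.\<close>

definition box :: "nat \<Rightarrow> nat \<Rightarrow> (nat \<Rightarrow>\<^sub>0 nat) set" where
  "box n q = {\<alpha> \<in> exponents n. \<forall>i<n. Poly_Mapping.lookup \<alpha> i < q}"

lemma finite_card_box: "finite (box n q)" "card (box n q) \<le> q ^ n"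
proof -
  let ?f = "\<lambda>\<alpha>. restrict (Poly_Mapping.lookup \<alpha>) {..<n}"
  have inj: "inj_on ?f (box n q)"
  proof (rule inj_onI, rule poly_mapping_eqI)
    fix \<alpha> \<beta> i assume *: "\<alpha> \<in> box n q" "\<beta> \<in> box n q" "?f \<alpha> = ?f \<beta>"
    show "Poly_Mapping.lookup \<alpha> i = Poly_Mapping.lookup \<beta> i"
    proof (cases "i < n")
      case True
      then show ?thesis using fun_cong[OF *(3), of i] by simp
    next
      case False
      then show ?thesis using * by (simp add: box_def in_exponents_iff)
    qed
  qed
  have im: "?f ` box n q \<subseteq> {..<n} \<rightarrow>\<^sub>E {..<q}" 
    by (intro image_subsetI restrict_PiE_iff[THEN iffD2]) (simp add: box_def)
  have fin: "finite ({..<n} \<rightarrow>\<^sub>E {..<q})" by (intro finite_PiE) auto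
  show "finite (box n q)" by (rule inj_on_finite[OF inj im fin])
  have "card (box n q) \<le> card ({..<n} \<rightarrow>\<^sub>E {..<q})" by (rule card_inj_on_le[OF inj im fin])
  then show "card (box n q) \<le> q ^ n" by (simp add: card_PiE)
qed

text \<open>For \<open>\<beta>\<close> in the box, \<open>exp_compl n q \<beta> + \<beta>\<close>
  has all entries \<open>q - 1\<close>, the only exponent in the box where the Cartier operator can
  be nonzero.\<close>

definition exp_compl :: "nat \<Rightarrow> nat \<Rightarrow> (nat \<Rightarrow>\<^sub>0 nat) \<Rightarrow> (nat \<Rightarrow>\<^sub>0 nat)" where
  "exp_compl n q \<beta> = (\<Sum>i<n. Poly_Mapping.single i (q - 1 - Poly_Mapping.lookup \<beta> i))"

lemma lookup_exp_compl:
  "Poly_Mapping.lookup (exp_compl n q \<beta>) i = (if i < n then q - 1 - Poly_Mapping.lookup \<beta> i else 0)"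
proof -
  have "(\<Sum>j<n. Poly_Mapping.lookup (Poly_Mapping.single j (q - 1 - Poly_Mapping.lookup \<beta> j)) i)
     = (\<Sum>j<n. if j = i then q - 1 - Poly_Mapping.lookup \<beta> j else 0)"
    by (intro sum.cong) (auto simp: lookup_single)
  then show ?thesis by (simp add: exp_compl_def lookup_sum)
qed

lemma exp_compl_in_exponents: "exp_compl n q \<beta> \<in> exponents n"
  by (simp add: in_exponents_iff lookup_exp_compl)

text \<open>One coordinate of the duality between a monomial and its complement. With
  \<open>a\<close> reduced modulo \<open>q\<close> the sum stays below \<open>2 * q\<close>, so it
  wraps around at most once.\<close>

lemma compl_mod_eq_iff:
  assumes "(b::nat) < q"
  shows "(q - 1 - b + a) mod q = q - 1 \<longleftrightarrow> b = a mod q"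
proof -
  have q: "q > 0" using assms by simp
  let ?r = "a mod q"
  have r: "?r < q" using q by simp
  have "(q - 1 - b + a) mod q = (q - 1 - b + ?r) mod q" by (simp add: mod_add_right_eq)
  also have "\<dots> = (if ?r \<le> b then q - 1 - b + ?r else ?r - b - 1)"
  proof (cases "?r \<le> b")
    case True
    then show ?thesis using assms by simp
  next
    case False
    then have *: "q - 1 - b + ?r = q + (?r - b - 1)" using assms by simp
    have "(q + (?r - b - 1)) mod q = ?r - b - 1"
      using r by (metis mod_add_self1 mod_less less_imp_diff_less)
    then show ?thesis unfolding * using False by simp
  qed
  finally have eq: "(q - 1 - b + a) mod q = (if ?r \<le> b then q - 1 - b + ?r else ?r - b - 1)" .
  show ?thesis
  proof (cases "?r \<le> b")
    case True
    have "q - 1 - b + ?r = q - 1 \<longleftrightarrow> b = ?r" using True assms by linarith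
    then show ?thesis unfolding eq using True by simp
  next
    case False
    have "?r - b - 1 \<noteq> q - 1" "b \<noteq> ?r" using False r assms by linarith+
    then show ?thesis unfolding eq using False by simp
  qed
qed

text \<open>Adding the complement of the residue raises the residue to \<open>q - 1\<close> without
  a carry.\<close>

lemma compl_div_eq: "q > 0 \<Longrightarrow> (q - 1 - a mod q + a) div q = (a::nat) div q"
proof -
  assume q: "q > 0"
  have "q - 1 - a mod q + a = q - 1 + q * (a div q)"
    using mod_less_divisor[OF q, of a] mult_div_mod_eq[of q a] by linarith
  moreover have "(q - 1 + q * (a div q)) div q = a div q + (q - 1) div q"
    using q by (intro div_mult_self2) simp
  ultimately show ?thesis using q by simp
qed

section \<open>Dual bases for the Frobenius\<close>

text \<open>A spanning set of least size has unique coordinates. Uniqueness makes each coordinate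
  function an element of \<open>frobenius_dual\<close>, hence a value of \<open>\<theta>\<close>,
  and right linearity turns that into \<open>\<theta> 1\<close> after a multiplication.\<close>

lemma frobenius_dual_basis_1:
  fixes \<theta> :: "'k::field \<Rightarrow> 'k \<Rightarrow> 'k"
  assumes p: "prime (CHAR('k))" and F: "F_finite_field TYPE('k)" and \<theta>: "frobenius_dual_iso \<theta>"
  obtains J :: "nat set" and b b' :: "nat \<Rightarrow> 'k"
  where "finite J" "\<And>c. c = (\<Sum>j\<in>J. \<theta> 1 (b' j * c) ^ CHAR('k) * b j)"
proof -
  let ?p = "CHAR('k)"
  define spans where "spans B \<longleftrightarrow> finite B \<and> (\<forall>c. \<exists>g. c = (\<Sum>b\<in>B. g b ^ ?p * b))"
    for B :: "'k set"
  obtain B0 where "spans B0" using F unfolding F_finite_field_def spans_def by blast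
  from ex_has_least_nat[of spans, OF this] obtain B
    where spans: "spans B" and min: "\<And>B'. spans B' \<Longrightarrow> card B \<le> card B'" by blast
  then have B: "finite B" by (simp add: spans_def)
  have "\<forall>c. \<exists>g. c = (\<Sum>b\<in>B. g b ^ ?p * b)" using spans by (simp add: spans_def)
  then obtain g where g: "\<And>c. c = (\<Sum>b\<in>B. g c b ^ ?p * b)" by (rule choice[THEN exE]) blast
  have frob: "(x + y) ^ ?p = x ^ ?p + y ^ ?p" for x y :: 'k
    using p by (rule freshmans_dream) simp
  have frob_diff: "(x - y) ^ ?p = x ^ ?p - y ^ ?p" for x y :: 'k
    using frob[of "x - y" y] by (simp add: algebra_simps)
  have unique: "h b0 = h' b0"
    if eq: "(\<Sum>b\<in>B. h b ^ ?p * b) = (\<Sum>b\<in>B. h' b ^ ?p * b)" and b0: "b0 \<in> B" for h h' b0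
  proof (rule ccontr)
    assume ne: "h b0 \<noteq> h' b0"
    \<comment> \<open>Two expansions give a relation whose coefficients are \<open>p\<close>-th
      powers of the \<open>d b\<close>; dividing by \<open>d b0 ^ ?p\<close> again leaves
      \<open>p\<close>-th powers, so \<open>b0\<close> can be eliminated.\<close>
    define d where "d b = h b - h' b" for b
    have "(\<Sum>b\<in>B. d b ^ ?p * b) = 0"
      using eq by (simp add: d_def frob_diff left_diff_distrib sum_subtractf)
    then have "d b0 ^ ?p * b0 = - (\<Sum>b\<in>B - {b0}. d b ^ ?p * b)"
      using B b0 by (simp add: sum.remove eq_neg_iff_add_eq_0)
    moreover have d0: "d b0 \<noteq> 0" using ne by (simp add: d_def)
    ultimately have "b0 = - (\<Sum>b\<in>B - {b0}. d b ^ ?p * b) / d b0 ^ ?p"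
      by (simp add: field_simps)
    also have "\<dots> = (\<Sum>b\<in>B - {b0}. - ((d b / d b0) ^ ?p) * b)"
      by (simp add: sum_divide_distrib power_divide sum_negf)
    finally have b0_eq: "b0 = (\<Sum>b\<in>B - {b0}. - ((d b / d b0) ^ ?p) * b)" .
    have b0_mult: "y ^ ?p * b0 = (\<Sum>b\<in>B - {b0}. - ((y * (d b / d b0)) ^ ?p) * b)" for y
    proof -
      have "y ^ ?p * b0 = y ^ ?p * (\<Sum>b\<in>B - {b0}. - ((d b / d b0) ^ ?p) * b)"
        using b0_eq by (rule arg_cong)
      also have "\<dots> = (\<Sum>b\<in>B - {b0}. - ((y * (d b / d b0)) ^ ?p) * b)"
        unfolding sum_distrib_left power_mult_distrib by (simp add: mult_ac)
      finally show ?thesis .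
    qed
    have "spans (B - {b0})"
      unfolding spans_def
    proof (intro conjI allI)
      fix c
      have "c = (\<Sum>b\<in>B. g c b ^ ?p * b)" by (rule g)
      also have "\<dots> = g c b0 ^ ?p * b0 + (\<Sum>b\<in>B - {b0}. g c b ^ ?p * b)"
        using B b0 by (simp add: sum.remove)
      also have "\<dots> = (\<Sum>b\<in>B - {b0}. (g c b - g c b0 * (d b / d b0)) ^ ?p * b)"
        unfolding b0_mult sum.distrib[symmetric] by (simp add: frob_diff left_diff_distrib)
      finally show "\<exists>g. c = (\<Sum>b\<in>B - {b0}. g b ^ ?p * b)"
        by (rule exI[of _ "\<lambda>b. g c b - g c b0 * (d b / d b0)"])
    qed (use B in auto)
    from min[OF this] B b0 show False
      by (metis card_Diff1_less not_le)
  qed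
  have dual: "(\<lambda>c. g c b) \<in> frobenius_dual" if b: "b \<in> B" for b
    unfolding frobenius_dual_def
  proof (intro CollectI conjI allI)
    fix x y
    have "(\<Sum>b\<in>B. g (x + y) b ^ ?p * b) = (\<Sum>b\<in>B. (g x b + g y b) ^ ?p * b)"
      using g[of x] g[of y] g[of "x + y"] by (simp add: frob distrib_right sum.distrib)
    then show "g (x + y) b = g x b + g y b" using b by (rule unique)
    have "(\<Sum>b\<in>B. g (x ^ ?p * y) b ^ ?p * b) = x ^ ?p * (\<Sum>b\<in>B. g y b ^ ?p * b)"
      using g[of y] g[of "x ^ ?p * y"] by simp
    also have "\<dots> = (\<Sum>b\<in>B. (x * g y b) ^ ?p * b)"
      by (simp add: power_mult_distrib sum_distrib_left mult_ac)
    finally show "g (x ^ ?p * y) b = x * g y b" using b by (rule unique)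
  qed
  have "\<exists>a. \<forall>c. g c b = \<theta> 1 (a * c)" if "b \<in> B" for b
  proof -
    from dual[OF that] \<theta> obtain a where "(\<lambda>c. g c b) = \<theta> a"
      unfolding frobenius_dual_iso_def bij_betw_def by (metis imageE)
    moreover have "\<theta> a c = \<theta> 1 (a * c)" for c
      using \<theta> unfolding frobenius_dual_iso_def by (metis mult_1)
    ultimately show ?thesis by metis
  qed
  then obtain a where a: "\<And>b c. b \<in> B \<Longrightarrow> g c b = \<theta> 1 (a b * c)" by metis
  obtain h where h: "bij_betw h {..<card B} B"
    using ex_bij_betw_nat_finite[of B] B by (auto simp: atLeast0LessThan)
  show thesis
  proof (rule that)
    fix c
    have "c = (\<Sum>b\<in>B. \<theta> 1 (a b * c) ^ ?p * b)" using g[of c] a by simp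
    also have "\<dots> = (\<Sum>j<card B. \<theta> 1 (a (h j) * c) ^ ?p * h j)"
      using h by (rule sum.reindex_bij_betw[symmetric])
    finally show "c = (\<Sum>j<card B. \<theta> 1 (a (h j) * c) ^ ?p * h j)" .
  qed simp
qed

lemma frobenius_dual_iterate:
  fixes \<theta> :: "'k::field \<Rightarrow> 'k \<Rightarrow> 'k"
  assumes \<theta>: "frobenius_dual_iso \<theta>"
  shows "(\<theta> 1 ^^ e) (a ^ (CHAR('k) ^ e) * x) = a * (\<theta> 1 ^^ e) x"
    and "(\<theta> 1 ^^ e) (x + y) = (\<theta> 1 ^^ e) x + (\<theta> 1 ^^ e) y"
    and "(\<theta> 1 ^^ e) 0 = 0"
proof -
  have "\<theta> 1 \<in> frobenius_dual" using \<theta> by (auto simp: frobenius_dual_iso_def bij_betw_def)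
  then have l: "\<theta> 1 (u + v) = \<theta> 1 u + \<theta> 1 v" "\<theta> 1 (u ^ CHAR('k) * v) = u * \<theta> 1 v" for u v
    by (simp_all add: frobenius_dual_def)
  show "(\<theta> 1 ^^ e) (a ^ (CHAR('k) ^ e) * x) = a * (\<theta> 1 ^^ e) x"
  proof (induction e arbitrary: a x)
    case (Suc e)
    have "(\<theta> 1 ^^ Suc e) (a ^ (CHAR('k) ^ Suc e) * x)
        = \<theta> 1 ((\<theta> 1 ^^ e) ((a ^ CHAR('k)) ^ (CHAR('k) ^ e) * x))"
      by (simp add: power_mult[symmetric])
    then show ?case using Suc l by simp
  qed simp
  show add: "(\<theta> 1 ^^ e) (x + y) = (\<theta> 1 ^^ e) x + (\<theta> 1 ^^ e) y" for x y
    by (induction e arbitrary: x y) (simp_all add: l)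
  show "(\<theta> 1 ^^ e) 0 = 0" using add[of 0 0] by (simp only: add_0_right add_cancel_right_right)
qed

text \<open>Each coordinate at level \<open>e\<close> is expanded once more by the level-one basis,
  and \<open>p ^ e\<close>-linearity of the iterate moves the dual elements inside. The new basis
  consists of the products of \<open>p ^ e\<close>-th powers of one basis with the other.\<close>

lemma frobenius_dual_basis:
  fixes \<theta> :: "'k::field \<Rightarrow> 'k \<Rightarrow> 'k"
  assumes p: "prime (CHAR('k))" and F: "F_finite_field TYPE('k)" and \<theta>: "frobenius_dual_iso \<theta>"
  shows "\<exists>(J :: nat set) b b'. finite J \<and>
    (\<forall>c. c = (\<Sum>j\<in>J. (\<theta> 1 ^^ e) (b' j * c) ^ (CHAR('k) ^ e) * b j))"
proof (induction e)
  case 0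
  show ?case by (intro exI[of _ "{0}"] exI[of _ "\<lambda>_. 1"]) simp
next
  case (Suc e)
  let ?p = "CHAR('k)" and ?l = "\<theta> 1"
  obtain J :: "nat set" and b b' where J: "finite J"
    and b: "\<And>c. c = (\<Sum>j\<in>J. (?l ^^ e) (b' j * c) ^ (?p ^ e) * b j)"
    using Suc by blast
  obtain M :: "nat set" and a a' where M: "finite M"
    and a: "\<And>c. c = (\<Sum>i\<in>M. ?l (a' i * c) ^ ?p * a i)"
    using frobenius_dual_basis_1[OF p F \<theta>] by metis
  \<comment> \<open>Pairs of indices are encoded as naturals so that the index type stays the same
    throughout the induction.\<close>
  define N where "N = prod_encode ` (J \<times> M)"
  define u where "u k = (case prod_decode k of (j, i) \<Rightarrow> a i ^ (?p ^ e) * b j)" for k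
  define v where "v k = (case prod_decode k of (j, i) \<Rightarrow> a' i ^ (?p ^ e) * b' j)" for k
  have "c = (\<Sum>k\<in>N. (?l ^^ Suc e) (v k * c) ^ (?p ^ Suc e) * u k)" for c
  proof -
    have "(?l ^^ e) (b' j * c) ^ (?p ^ e) =
        (\<Sum>i\<in>M. (?l ^^ Suc e) (a' i ^ (?p ^ e) * b' j * c) ^ (?p ^ Suc e) * a i ^ (?p ^ e))" for j
    proof -
      let ?x = "(?l ^^ e) (b' j * c)"
      have "?x ^ (?p ^ e) = (\<Sum>i\<in>M. ?l (a' i * ?x) ^ ?p * a i) ^ (?p ^ e)"
        using a[of ?x] by simp
      also have "\<dots> = (\<Sum>i\<in>M. (?l (a' i * ?x) ^ ?p * a i) ^ (?p ^ e))"
        using p by (intro freshmans_dream_sum') simp_all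
      also have "\<dots> = (\<Sum>i\<in>M. ?l (a' i * ?x) ^ (?p ^ Suc e) * a i ^ (?p ^ e))"
        by (simp add: power_mult_distrib power_mult)
      finally show ?thesis
        using frobenius_dual_iterate(1)[OF \<theta>, of e, symmetric] by (simp add: mult.assoc)
    qed
    then have "c = (\<Sum>j\<in>J. \<Sum>i\<in>M. (?l ^^ Suc e) (a' i ^ (?p ^ e) * b' j * c) ^ (?p ^ Suc e)
        * (a i ^ (?p ^ e) * b j))"
      using b[of c] by (simp add: sum_distrib_right mult.assoc del: funpow.simps)
    also have "\<dots> = (\<Sum>k\<in>N. (?l ^^ Suc e) (v k * c) ^ (?p ^ Suc e) * u k)"
      unfolding N_def
      by (subst sum.reindex)
         (auto simp: u_def v_def sum.cartesian_product inj_prod_encode case_prod_beta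
           simp del: funpow.simps power_Suc intro!: sum.cong)
    finally show ?thesis .
  qed
  moreover have "finite N" using J M by (simp add: N_def)
  ultimately show ?case by blast
qed

section \<open>The Cartier operator: monomials, composition, dual basis\<close>

lemma cartier_maps_poly_ring:
  assumes K: "K \<in> cartier_maps p (poly_ring n) e"
  shows "f \<in> carrier (poly_ring n) \<Longrightarrow> K f \<in> carrier (poly_ring n)"
    and "f \<in> carrier (poly_ring n) \<Longrightarrow> g \<in> carrier (poly_ring n) \<Longrightarrow> K (f ^ (p ^ e) * g) = f * K g"
    and "finite A \<Longrightarrow> (\<And>x. x \<in> A \<Longrightarrow> h x \<in> carrier (poly_ring n)) \<Longrightarrow> K (sum h A) = (\<Sum>x\<in>A. K (h x))"
    and "K 0 = 0"
proof -
  interpret cring "poly_ring n" by (rule cring_poly_ring)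
  show cl: "f \<in> carrier (poly_ring n) \<Longrightarrow> K f \<in> carrier (poly_ring n)" for f
    by (rule cartier_maps_closed[OF K])
  show "f \<in> carrier (poly_ring n) \<Longrightarrow> g \<in> carrier (poly_ring n) \<Longrightarrow> K (f ^ (p ^ e) * g) = f * K g"
    using cartier_maps_pow[OF K, of f g] by (simp add: poly_ring_pow)
  show "K (sum h A) = (\<Sum>x\<in>A. K (h x))"
    if "finite A" "\<And>x. x \<in> A \<Longrightarrow> h x \<in> carrier (poly_ring n)"
    using cartier_maps_finsum[OF K that(1), of h] that cl by (simp add: poly_ring_finsum Pi_def)
  show "K 0 = 0" using cartier_maps_zero[OF K] by simp
qed

locale cartier_operator_setup =
  fixes n p :: nat and \<theta> :: "'k::field \<Rightarrow> 'k \<Rightarrow> 'k" and \<kappa> :: "nat \<Rightarrow> 'k mpoly \<Rightarrow> 'k mpoly"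
  assumes CHAR: "CHAR('k) = p" and p: "prime p"
    and \<theta>: "frobenius_dual_iso \<theta>" and \<kappa>: "cartier_operator n (\<theta> 1) \<kappa>"
begin

lemma \<kappa>_cartier_map: "\<kappa> e \<in> cartier_maps p (poly_ring n) e"
  using \<kappa> CHAR by (simp add: cartier_operator_def)

text \<open>The quotient part of the exponent forms a \<open>p ^ e\<close>-th power, which leaves
  \<open>\<kappa> e\<close> as a factor; the residue is covered by the defining values.\<close>

lemma \<kappa>_single:
  assumes \<alpha>: "\<alpha> \<in> exponents n"
  shows "\<kappa> e (Poly_Mapping.single \<alpha> c) =
    (if \<forall>i<n. Poly_Mapping.lookup \<alpha> i mod p ^ e = p ^ e - 1
     then Poly_Mapping.single (exp_div (p ^ e) \<alpha>) ((\<theta> 1 ^^ e) c) else 0)"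
proof -
  let ?q = "p ^ e"
  have q: "?q > 0" using p by (simp add: prime_gt_0_nat)
  let ?d = "Poly_Mapping.single (exp_div ?q \<alpha>) (1::'k)" and ?m = "Poly_Mapping.single (exp_mod ?q \<alpha>) c"
  have "Poly_Mapping.single \<alpha> c = ?d ^ ?q * ?m"
    using exp_div_mod[of ?q \<alpha>] by (simp add: single_power mult_single del: sum_constant)
  then have "\<kappa> e (Poly_Mapping.single \<alpha> c) = ?d * \<kappa> e ?m"
    using cartier_maps_poly_ring(2)[OF \<kappa>_cartier_map, of ?d ?m e] \<alpha>
    by (simp add: single_in_poly_ring exp_div_in_exponents exp_mod_in_exponents)
  moreover have "\<kappa> e ?m = (if \<forall>i<n. Poly_Mapping.lookup (exp_mod ?q \<alpha>) i = ?q - 1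
      then Poly_Mapping.single 0 ((\<theta> 1 ^^ e) c) else 0)"
  proof -
    have "Poly_Mapping.lookup (exp_mod ?q \<alpha>) i \<le> ?q - 1" for i
      using mod_less_divisor[OF q, of "Poly_Mapping.lookup \<alpha> i"] by simp
    then show ?thesis
      using \<kappa> exp_mod_in_exponents[OF \<alpha>, of ?q] unfolding cartier_operator_def CHAR by blast
  qed
  ultimately show ?thesis by (auto simp: mult_single)
qed

text \<open>By additivity this is a claim about monomials. There it says that iterated quotients
  compose and that the nonvanishing condition can be checked on base-\<open>p\<close> digits in two
  batches.\<close>

lemma \<kappa>_comp:
  assumes s: "s \<in> carrier (poly_ring n)"
  shows "\<kappa> a (\<kappa> b s) = \<kappa> (a + b) s"
proof -
  have pos: "p ^ a > 0" "p ^ b > 0" using p by (simp_all add: prime_gt_0_nat)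
  \<comment> \<open>The lowest \<open>a + b\<close> digits of \<open>x\<close> are all
    \<open>p - 1\<close> exactly when this holds for the lowest \<open>b\<close>, recorded in
    \<open>y\<close>, and for the next \<open>a\<close>, recorded in \<open>z\<close>.\<close>
  have mod_iff: "x mod p ^ (a + b) = p ^ (a + b) - 1 \<longleftrightarrow>
      x mod p ^ b = p ^ b - 1 \<and> x div p ^ b mod p ^ a = p ^ a - 1" for x :: nat
  proof -
    define y z where "y = x mod p ^ b" and "z = x div p ^ b mod p ^ a"
    have yz: "y < p ^ b" "z < p ^ a" using pos by (simp_all add: y_def z_def)
    have x: "x mod p ^ (a + b) = p ^ b * z + y"
      using mod_mult2_eq[of x "p ^ b" "p ^ a"] by (simp add: y_def z_def power_add mult.commute)
    have P: "p ^ (a + b) = p ^ b * p ^ a" by (simp add: power_add mult.commute)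
    have top: "p ^ b * z + p ^ b = p ^ b * p ^ a" if "z = p ^ a - 1"
    proof -
      have "z + 1 = p ^ a" using that pos by linarith
      then show ?thesis by (metis distrib_left mult.right_neutral)
    qed
    have "p ^ b * z + y = p ^ b * p ^ a - 1 \<longleftrightarrow> y = p ^ b - 1 \<and> z = p ^ a - 1"
    proof
      assume *: "p ^ b * z + y = p ^ b * p ^ a - 1"
      have "z = p ^ a - 1"
      proof (rule ccontr)
        assume "z \<noteq> p ^ a - 1"
        then have "z + 2 \<le> p ^ a" using yz by linarith
        then have "p ^ b * (z + 2) \<le> p ^ b * p ^ a" by (rule mult_le_mono2)
        then show False using * yz pos by (simp add: algebra_simps)
      qed
      moreover from this have "p ^ b * z + p ^ b = p ^ b * p ^ a" by (rule top)
      then have "y = p ^ b - 1" using * yz by linarith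
      ultimately show "y = p ^ b - 1 \<and> z = p ^ a - 1" by simp
    next
      assume *: "y = p ^ b - 1 \<and> z = p ^ a - 1"
      then have "p ^ b * z + p ^ b = p ^ b * p ^ a" using top by blast
      then show "p ^ b * z + y = p ^ b * p ^ a - 1" using * pos by linarith
    qed
    then show ?thesis unfolding x unfolding P y_def z_def .
  qed
  have div_eq: "exp_div (p ^ a) (exp_div (p ^ b) \<alpha>) = exp_div (p ^ (a + b)) \<alpha>" for \<alpha>
    by (rule poly_mapping_eqI) (simp add: div_mult2_eq[symmetric] power_add mult.commute)
  have single: "\<kappa> a (\<kappa> b (Poly_Mapping.single \<alpha> c)) = \<kappa> (a + b) (Poly_Mapping.single \<alpha> c)"
    if \<alpha>: "\<alpha> \<in> exponents n" for \<alpha> c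
  proof (cases "\<forall>i<n. Poly_Mapping.lookup \<alpha> i mod p ^ b = p ^ b - 1")
    case True
    have "(\<forall>i<n. Poly_Mapping.lookup (exp_div (p ^ b) \<alpha>) i mod p ^ a = p ^ a - 1) \<longleftrightarrow>
        (\<forall>i<n. Poly_Mapping.lookup \<alpha> i mod p ^ (a + b) = p ^ (a + b) - 1)"
      unfolding mod_iff lookup_exp_div using True by blast
    moreover have "\<kappa> b (Poly_Mapping.single \<alpha> c) =
        Poly_Mapping.single (exp_div (p ^ b) \<alpha>) ((\<theta> 1 ^^ b) c)"
      unfolding \<kappa>_single[OF \<alpha>] using True by (rule if_P)
    ultimately show ?thesis
      unfolding \<kappa>_single[OF \<alpha>, of "a + b"]
      by (simp only: \<kappa>_single[OF exp_div_in_exponents[OF \<alpha>]] div_eq funpow_add o_apply)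
  next
    case False
    then have "\<kappa> b (Poly_Mapping.single \<alpha> c) = 0" unfolding \<kappa>_single[OF \<alpha>] by (rule if_not_P)
    moreover have "\<not> (\<forall>i<n. Poly_Mapping.lookup \<alpha> i mod p ^ (a + b) = p ^ (a + b) - 1)"
      using False unfolding mod_iff by blast
    then have "\<kappa> (a + b) (Poly_Mapping.single \<alpha> c) = 0"
      unfolding \<kappa>_single[OF \<alpha>] by (rule if_not_P)
    ultimately show ?thesis by (simp add: cartier_maps_poly_ring(4)[OF \<kappa>_cartier_map])
  qed
  let ?m = "\<lambda>\<alpha>. Poly_Mapping.single \<alpha> (Poly_Mapping.lookup s \<alpha>)"
  have m: "?m \<alpha> \<in> carrier (poly_ring n)" if "\<alpha> \<in> Poly_Mapping.keys s" for \<alpha>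
    using that s by (intro single_in_poly_ring) (auto simp: in_poly_ring_iff)
  have "\<kappa> a (\<kappa> b (\<Sum>\<alpha>\<in>Poly_Mapping.keys s. ?m \<alpha>)) = (\<Sum>\<alpha>\<in>Poly_Mapping.keys s. \<kappa> a (\<kappa> b (?m \<alpha>)))"
    using m cartier_maps_poly_ring(1)[OF \<kappa>_cartier_map]
    by (simp add: cartier_maps_poly_ring(3)[OF \<kappa>_cartier_map])
  also have "\<dots> = (\<Sum>\<alpha>\<in>Poly_Mapping.keys s. \<kappa> (a + b) (?m \<alpha>))"
    using s by (intro sum.cong single) (auto simp: in_poly_ring_iff)
  also have "\<dots> = \<kappa> (a + b) (\<Sum>\<alpha>\<in>Poly_Mapping.keys s. ?m \<alpha>)"
    using m by (simp add: cartier_maps_poly_ring(3)[OF \<kappa>_cartier_map])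
  finally show ?thesis unfolding sum_of_monomials[symmetric] .
qed

text \<open>The monomials with exponents below \<open>p\<^sup>e\<close>, with coefficients from a basis of \<open>k\<close> over
  \<open>k\<^bsup>p\<^sup>e\<^esup>\<close>, have dual basis the complementary monomials with coefficients from the dual basis.\<close>

lemma \<kappa>_dual_basis:
  assumes b: "\<And>c. c = (\<Sum>j\<in>J. (\<theta> 1 ^^ e) (b' j * c) ^ (p ^ e) * b j)" and J: "finite J"
    and s: "s \<in> carrier (poly_ring n)"
  shows "s = (\<Sum>(j, \<beta>)\<in>J \<times> box n (p ^ e).
    \<kappa> e (Poly_Mapping.single (exp_compl n (p ^ e) \<beta>) (b' j) * s) ^ (p ^ e) * Poly_Mapping.single \<beta> (b j))"
proof -
  let ?q = "p ^ e"
  have q: "?q > 0" using p by (simp add: prime_gt_0_nat)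
  let ?v = "\<lambda>j \<beta>. Poly_Mapping.single (exp_compl n ?q \<beta>) (b' j)"
  \<comment> \<open>\<open>T\<close> is the claimed expansion; it is additive, so it only has to be
    compared with the identity on monomials.\<close>
  define T where
    "T s = (\<Sum>(j, \<beta>)\<in>J \<times> box n ?q. \<kappa> e (?v j \<beta> * s) ^ ?q * Poly_Mapping.single \<beta> (b j))" for s
  have v: "?v j \<beta> \<in> carrier (poly_ring n)" for j \<beta>
    by (intro single_in_poly_ring exp_compl_in_exponents)
  have T_single: "T (Poly_Mapping.single \<alpha> c) = Poly_Mapping.single \<alpha> c" if \<alpha>: "\<alpha> \<in> exponents n" for \<alpha> c
  proof -
    have md: "exp_mod ?q \<alpha> \<in> box n ?q"
      using \<alpha> q by (simp add: box_def exp_mod_in_exponents)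
    \<comment> \<open>Among the box exponents only the residue of \<open>\<alpha>\<close>
      contributes, which collapses the inner sum to one term.\<close>
    have summand: "\<kappa> e (?v j \<beta> * Poly_Mapping.single \<alpha> c) ^ ?q * Poly_Mapping.single \<beta> (b j) =
        (if \<beta> = exp_mod ?q \<alpha> then Poly_Mapping.single \<alpha> ((\<theta> 1 ^^ e) (b' j * c) ^ ?q * b j) else 0)"
      if \<beta>: "\<beta> \<in> box n ?q" for j \<beta>
    proof -
      let ?\<gamma> = "exp_compl n ?q \<beta> + \<alpha>"
      have \<gamma>: "?\<gamma> \<in> exponents n" using \<alpha> by (intro add_in_exponents exp_compl_in_exponents)
      have "(\<forall>i<n. Poly_Mapping.lookup ?\<gamma> i mod ?q = ?q - 1) \<longleftrightarrow>
          (\<forall>i<n. Poly_Mapping.lookup \<beta> i = Poly_Mapping.lookup \<alpha> i mod ?q)"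
      proof -
        have "Poly_Mapping.lookup ?\<gamma> i mod ?q = ?q - 1 \<longleftrightarrow>
            Poly_Mapping.lookup \<beta> i = Poly_Mapping.lookup \<alpha> i mod ?q" if "i < n" for i
          using that \<beta> compl_mod_eq_iff[of "Poly_Mapping.lookup \<beta> i" ?q "Poly_Mapping.lookup \<alpha> i"]
          by (simp add: lookup_add lookup_exp_compl box_def)
        then show ?thesis by blast
      qed
      also have "\<dots> \<longleftrightarrow> \<beta> = exp_mod ?q \<alpha>"
      proof
        assume *: "\<forall>i<n. Poly_Mapping.lookup \<beta> i = Poly_Mapping.lookup \<alpha> i mod ?q"
        show "\<beta> = exp_mod ?q \<alpha>"
        proof (rule poly_mapping_eqI)
          fix i
          show "Poly_Mapping.lookup \<beta> i = Poly_Mapping.lookup (exp_mod ?q \<alpha>) i"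
            using * \<alpha> \<beta> by (cases "i < n") (simp_all add: box_def in_exponents_iff)
        qed
      qed simp
      finally have cond: "(\<forall>i<n. Poly_Mapping.lookup ?\<gamma> i mod ?q = ?q - 1) \<longleftrightarrow> \<beta> = exp_mod ?q \<alpha>" .
      have eq: "\<kappa> e (?v j \<beta> * Poly_Mapping.single \<alpha> c) =
          (if \<beta> = exp_mod ?q \<alpha> then Poly_Mapping.single (exp_div ?q ?\<gamma>) ((\<theta> 1 ^^ e) (b' j * c)) else 0)"
        unfolding mult_single \<kappa>_single[OF \<gamma>] cond ..
      show ?thesis
      proof (cases "\<beta> = exp_mod ?q \<alpha>")
        case True
        have "exp_div ?q ?\<gamma> = exp_div ?q \<alpha>"
        proof (rule poly_mapping_eqI)
          fix i
          show "Poly_Mapping.lookup (exp_div ?q ?\<gamma>) i = Poly_Mapping.lookup (exp_div ?q \<alpha>) i"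
            using compl_div_eq[OF q] \<alpha> True
            by (cases "i < n") (simp_all add: lookup_add lookup_exp_compl in_exponents_iff)
        qed
        then show ?thesis
          using True exp_div_mod[of ?q \<alpha>] unfolding eq
          by (simp add: single_power mult_single del: sum_constant)
      next
        case False
        then show ?thesis unfolding eq by (simp add: zero_power[OF q])
      qed
    qed
    have "T (Poly_Mapping.single \<alpha> c) = (\<Sum>j\<in>J. \<Sum>\<beta>\<in>box n ?q.
        if \<beta> = exp_mod ?q \<alpha> then Poly_Mapping.single \<alpha> ((\<theta> 1 ^^ e) (b' j * c) ^ ?q * b j) else 0)"
      unfolding T_def sum.cartesian_product[symmetric] by (intro sum.cong refl summand)
    also have "\<dots> = (\<Sum>j\<in>J. Poly_Mapping.single \<alpha> ((\<theta> 1 ^^ e) (b' j * c) ^ ?q * b j))"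
      using md finite_card_box(1)[of n ?q] by (simp add: sum.delta)
    also have "\<dots> = Poly_Mapping.single \<alpha> c"
      unfolding single_sum[symmetric] using b[of c] by simp
    finally show ?thesis .
  qed
  let ?m = "\<lambda>\<alpha>. Poly_Mapping.single \<alpha> (Poly_Mapping.lookup s \<alpha>)"
  have m: "?m \<alpha> \<in> carrier (poly_ring n)" if "\<alpha> \<in> Poly_Mapping.keys s" for \<alpha>
    using that s by (intro single_in_poly_ring) (auto simp: in_poly_ring_iff)
  have T_sum: "T (\<Sum>\<alpha>\<in>Poly_Mapping.keys s. ?m \<alpha>) = (\<Sum>\<alpha>\<in>Poly_Mapping.keys s. T (?m \<alpha>))"
  proof -
    have "\<kappa> e (?v j \<beta> * (\<Sum>\<alpha>\<in>Poly_Mapping.keys s. ?m \<alpha>)) ^ ?q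
        = (\<Sum>\<alpha>\<in>Poly_Mapping.keys s. \<kappa> e (?v j \<beta> * ?m \<alpha>) ^ ?q)" for j \<beta>
    proof -
      have "\<kappa> e (?v j \<beta> * (\<Sum>\<alpha>\<in>Poly_Mapping.keys s. ?m \<alpha>))
          = (\<Sum>\<alpha>\<in>Poly_Mapping.keys s. \<kappa> e (?v j \<beta> * ?m \<alpha>))"
        unfolding sum_distrib_left
        using m v by (intro cartier_maps_poly_ring(3)[OF \<kappa>_cartier_map] poly_ring_mult) auto
      \<comment> \<open>Additivity of \<open>\<kappa> e\<close> survives the outer power by the
        freshman's dream in characteristic \<open>p\<close>.\<close>
      then show ?thesis
        using p CHAR CHAR_mpoly[where 'k = 'k] by (simp only:) (rule freshmans_dream_sum', simp_all)
    qed
    then have "T (\<Sum>\<alpha>\<in>Poly_Mapping.keys s. ?m \<alpha>) = (\<Sum>(j, \<beta>)\<in>J \<times> box n ?q.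
        \<Sum>\<alpha>\<in>Poly_Mapping.keys s. \<kappa> e (?v j \<beta> * ?m \<alpha>) ^ ?q * Poly_Mapping.single \<beta> (b j))"
      unfolding T_def by (simp only: sum_distrib_right)
    also have "\<dots> = (\<Sum>\<alpha>\<in>Poly_Mapping.keys s. T (?m \<alpha>))"
      unfolding T_def case_prod_beta by (rule sum.swap)
    finally show ?thesis .
  qed
  have "T s = (\<Sum>\<alpha>\<in>Poly_Mapping.keys s. T (?m \<alpha>))"
    using T_sum unfolding sum_of_monomials[symmetric] .
  also have "\<dots> = (\<Sum>\<alpha>\<in>Poly_Mapping.keys s. ?m \<alpha>)"
    using s by (intro sum.cong T_single) (auto simp: in_poly_ring_iff)
  finally show ?thesis
    unfolding T_def using sum_of_monomials[of s] by simp
qed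

text \<open>Supplies the dual bases of the abstract setting, indexed by pairs of a basis index for
  the field and an exponent in the box.\<close>

lemma fedder_poly_ring:
  fixes I :: "'k mpoly set"
  assumes F: "F_finite_field TYPE('k)" and I: "ideal I (poly_ring n)"
  obtains J :: "(nat \<times> (nat \<Rightarrow>\<^sub>0 nat)) set" and u v
  where "fedder (poly_ring n) I p e (\<kappa> e) J u v"
proof -
  obtain J :: "nat set" and b b' where J: "finite J"
    and b: "\<And>c. c = (\<Sum>j\<in>J. (\<theta> 1 ^^ e) (b' j * c) ^ (p ^ e) * b j)"
    using frobenius_dual_basis[OF _ F \<theta>, of e] p unfolding CHAR by blast
  let ?J = "J \<times> box n (p ^ e)"
  let ?u = "\<lambda>(j, \<beta>). Poly_Mapping.single \<beta> (b j)"
  let ?v = "\<lambda>(j, \<beta>). Poly_Mapping.single (exp_compl n (p ^ e) \<beta>) (b' j)"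
  have u: "?u j \<in> carrier (poly_ring n)" if "j \<in> ?J" for j
    using that by (auto simp: box_def intro: single_in_poly_ring)
  have v: "?v j \<in> carrier (poly_ring n)" for j
    by (auto split: prod.split intro!: single_in_poly_ring exp_compl_in_exponents)
  have fin: "finite ?J" using J finite_card_box(1) by simp
  have "fedder (poly_ring n) I p e (\<kappa> e) ?J ?u ?v"
  proof (intro fedder.intro cring_poly_ring I fedder_axioms.intro \<kappa>_cartier_map u v fin)
    fix s :: "'k mpoly" assume s: "s \<in> carrier (poly_ring n)"
    have "(\<Sum>j\<in>?J. \<kappa> e (?v j * s) ^ (p ^ e) * ?u j) = s"
      using \<kappa>_dual_basis[OF b J s] by (simp add: case_prod_beta)
    moreover have "\<kappa> e (?v j * s) ^ (p ^ e) * ?u j \<in> carrier (poly_ring n)" if "j \<in> ?J" for j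
      using that s u v
      by (intro poly_ring_mult poly_ring_power cartier_maps_poly_ring(1)[OF \<kappa>_cartier_map])
    ultimately show "s = (\<Oplus>\<^bsub>poly_ring n\<^esub>j\<in>?J. (\<kappa> e (?v j \<otimes>\<^bsub>poly_ring n\<^esub> s)
        [^]\<^bsub>poly_ring n\<^esub> (p ^ e)) \<otimes>\<^bsub>poly_ring n\<^esub> ?u j)"
      using fin by (simp add: poly_ring_finsum poly_ring_pow)
  qed
  then show thesis by (rule that)
qed

end

section \<open>Irredundant generating systems\<close>

text \<open>Scalars are constant polynomials, so a generator in the \<open>k\<close>-span of the
  others would be redundant; hence \<open>A\<close> is linearly independent. It lies in a span of
  few monomials, which bounds its size.\<close>

lemma minimal_generators_card_le:
  fixes A :: "'k::field mpoly set"
  assumes Q: "ideal Q (poly_ring n)" and A: "minimal_generators (poly_ring n) Q J A"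
  shows "card A \<le> (max_degree A + 1) ^ n"
proof -
  define scale where "scale c f = Poly_Mapping.single 0 c * f" for c :: 'k and f :: "'k mpoly"
  interpret vs: vector_space scale
    by unfold_locales (simp_all add: scale_def algebra_simps single_add mult_single flip: mult.assoc)
  interpret S: cring "poly_ring n" by (rule cring_poly_ring)
  interpret Q: ideal Q "poly_ring n" by (rule Q)
  interpret \<pi>: ring_hom_cring "poly_ring n" "poly_ring n Quot Q" "\<lambda>f. Q +>\<^bsub>poly_ring n\<^esub> f"
    by (rule Q.rcos_ring_hom_cring) (rule cring_poly_ring)
  let ?\<pi> = "\<lambda>f. Q +>\<^bsub>poly_ring n\<^esub> f"
  have fin: "finite A" and AS: "A \<subseteq> carrier (poly_ring n)"
    and gen: "genideal (poly_ring n Quot Q) (?\<pi> ` A) = J"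
    and min: "\<And>B. B \<subset> A \<Longrightarrow> genideal (poly_ring n Quot Q) (?\<pi> ` B) \<noteq> J"
    using A by (auto simp: minimal_generators_def)
  have "vs.independent A"
    unfolding vs.dependent_def
  proof (rule notI, elim bexE)
    fix a assume a: "a \<in> A" "a \<in> vs.span (A - {a})"
    let ?B = "?\<pi> ` (A - {a})"
    let ?G = "genideal (poly_ring n Quot Q) ?B"
    have B: "?B \<subseteq> carrier (poly_ring n Quot Q)" using AS \<pi>.hom_closed by blast
    interpret G: ideal ?G "poly_ring n Quot Q" by (rule \<pi>.S.genideal_ideal[OF B])
    \<comment> \<open>Polynomials whose class is generated by the other generators form a subspace,
      which contains \<open>A - {a}\<close> and therefore its span.\<close>
    define W where "W = {f \<in> carrier (poly_ring n). ?\<pi> f \<in> ?G}"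
    have "vs.subspace W"
    proof (rule vs.subspaceI)
      show "0 \<in> W" using \<pi>.hom_zero by (simp add: W_def in_poly_ring_iff)
      show "f + g \<in> W" if "f \<in> W" "g \<in> W" for f g
        using that \<pi>.hom_add[of f g] by (simp add: W_def poly_ring_add G.a_closed)
      show "scale c f \<in> W" if "f \<in> W" for c f
      proof -
        have c: "Poly_Mapping.single 0 c \<in> carrier (poly_ring n)"
          by (simp add: single_in_poly_ring in_exponents_iff)
        with that \<pi>.hom_mult[OF c, of f] show ?thesis
          by (simp add: W_def scale_def poly_ring_mult G.I_l_closed)
      qed
    qed
    moreover have "A - {a} \<subseteq> W"
      using AS \<pi>.S.genideal_self[OF B] by (auto simp: W_def)
    ultimately have "a \<in> W" using a vs.span_minimal by blast
    with \<open>A - {a} \<subseteq> W\<close> have "?\<pi> ` A \<subseteq> ?G" by (auto simp: W_def)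
    then have "genideal (poly_ring n Quot Q) (?\<pi> ` A) \<subseteq> ?G"
      by (rule \<pi>.S.genideal_minimal[OF G.is_ideal])
    moreover have "?G \<subseteq> genideal (poly_ring n Quot Q) (?\<pi> ` A)"
    proof -
      have A': "?\<pi> ` A \<subseteq> carrier (poly_ring n Quot Q)" using AS \<pi>.hom_closed by blast
      show ?thesis
        using \<pi>.S.genideal_self[OF A'] by (intro \<pi>.S.genideal_minimal \<pi>.S.genideal_ideal A') blast
    qed
    ultimately show False using min[of "A - {a}"] gen a by blast
  qed
  \<comment> \<open>A bound on the total degree bounds every single exponent, so all monomials of
    \<open>A\<close> have exponents in this box.\<close>
  define T where "T = (\<lambda>\<alpha>. Poly_Mapping.single \<alpha> (1::'k)) ` box n (max_degree A + 1)"
  have "A \<subseteq> vs.span T"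
  proof
    fix f assume f: "f \<in> A"
    have "Poly_Mapping.single \<alpha> (Poly_Mapping.lookup f \<alpha>) \<in> vs.span T"
      if \<alpha>: "\<alpha> \<in> Poly_Mapping.keys f" for \<alpha>
    proof -
      have "Poly_Mapping.lookup \<alpha> i \<le> max_degree A" for i
      proof -
        have "Poly_Mapping.lookup \<alpha> i \<le> (\<Sum>i\<in>Poly_Mapping.keys \<alpha>. Poly_Mapping.lookup \<alpha> i)"
          by (cases "i \<in> Poly_Mapping.keys \<alpha>") (auto simp: in_keys_iff intro: member_le_sum)
        also have "\<dots> \<le> total_degree f" unfolding total_degree_def using \<alpha> by (intro Max_ge) auto
        also have "\<dots> \<le> max_degree A" unfolding max_degree_def using f fin by (intro Max_ge) auto
        finally show ?thesis .
      qed
      moreover have "f \<in> carrier (poly_ring n)" using f AS by blast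
      then have "\<alpha> \<in> exponents n" using \<alpha> by (auto simp: in_poly_ring_iff)
      ultimately have "Poly_Mapping.single \<alpha> 1 \<in> T" by (auto simp: T_def box_def less_Suc_eq_le)
      then have "scale (Poly_Mapping.lookup f \<alpha>) (Poly_Mapping.single \<alpha> 1) \<in> vs.span T"
        by (intro vs.span_scale vs.span_base)
      then show ?thesis by (simp add: scale_def mult_single)
    qed
    then show "f \<in> vs.span T" by (subst sum_of_monomials) (rule vs.span_sum)
  qed
  moreover have "finite T" using finite_card_box(1) by (simp add: T_def)
  ultimately have "card A \<le> card T"
    using vs.independent_span_bound \<open>vs.independent A\<close> by blast
  also have "\<dots> \<le> card (box n (max_degree A + 1))"
    unfolding T_def by (rule card_image_le[OF finite_card_box(1)])
  also have "\<dots> \<le> (max_degree A + 1) ^ n" by (rule finite_card_box(2))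
  finally show ?thesis .
qed

lemma max_degree_0_constant:
  assumes "finite A" "max_degree A = 0" "f \<in> A"
  obtains c where "f = Poly_Mapping.single 0 c"
proof -
  have "total_degree f \<le> max_degree A" unfolding max_degree_def using assms by (intro Max_ge) auto
  then have "total_degree f = 0" using assms by simp
  have "\<alpha> = 0" if "\<alpha> \<in> Poly_Mapping.keys f" for \<alpha>
  proof -
    have "(\<Sum>i\<in>Poly_Mapping.keys \<alpha>. Poly_Mapping.lookup \<alpha> i) \<le> total_degree f"
      unfolding total_degree_def using that by (intro Max_ge) auto
    then have "Poly_Mapping.lookup \<alpha> i = 0" for i
      using \<open>total_degree f = 0\<close> by (cases "i \<in> Poly_Mapping.keys \<alpha>") (auto simp: in_keys_iff)
    then show ?thesis by (intro poly_mapping_eqI) simp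
  qed
  then have "f = Poly_Mapping.single 0 (Poly_Mapping.lookup f 0)"
    by (intro poly_mapping_eqI) (auto simp: lookup_single when_def in_keys_iff)
  then show thesis by (rule that)
qed

text \<open>\<open>E\<close> is eventually constant on each residue class modulo a positive element of \<open>E\<close>.\<close>

lemma additively_closed_eventually_decomposable:
  fixes E :: "nat set"
  assumes add: "\<And>a b. a \<in> E \<Longrightarrow> b \<in> E \<Longrightarrow> a + b \<in> E"
  obtains N where "\<And>e. e \<in> E \<Longrightarrow> e \<ge> N \<Longrightarrow> \<exists>a\<in>E. \<exists>b\<in>E. 0 < a \<and> 0 < b \<and> e = a + b"
proof (cases "\<exists>a\<in>E. 0 < a")
  case False
  then show ?thesis using that[of 1] by (metis less_le_trans zero_less_one)
next
  case True
  then obtain a where a: "a \<in> E" "0 < a" by blast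
  \<comment> \<open>A representative of the class \<open>r\<close> if \<open>E\<close> meets it, and
    an arbitrary number otherwise, which only enlarges the threshold.\<close>
  define w where "w r = (SOME x. x \<in> E \<and> x mod a = r)" for r
  show ?thesis
  proof (rule that)
    \<comment> \<open>The sum dominates each \<open>w r\<close>; the extra \<open>a + 1\<close>
      ensures that \<open>x + a * j'\<close> is still positive after one \<open>a\<close> is split
      off.\<close>
    fix e assume e: "e \<in> E" "e \<ge> (\<Sum>r<a. w r) + a + 1"
    define x where "x = w (e mod a)"
    have x: "x \<in> E" "x mod a = e mod a"
      unfolding x_def w_def by (rule someI2[where a = e], use e in simp_all)+
    have "x \<le> (\<Sum>r<a. w r)"
      unfolding x_def using a by (intro member_le_sum) auto
    then have xe: "x + a < e" using e by linarith
    have "a dvd e - x" using x xe by (metis less_imp_le_nat mod_eq_dvd_iff_nat add_leD1)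
    then obtain j where j: "e - x = a * j" by (rule dvdE)
    then have "j \<noteq> 0" using xe by (metis add_lessD1 mult_0_right zero_less_diff less_irrefl)
    then obtain j' where "j = Suc j'" using not0_implies_Suc by blast
    then have e_eq: "e = (x + a * j') + a" using j xe by simp
    have "x + a * i \<in> E" for i
    proof (induction i)
      case (Suc i)
      then have "(x + a * i) + a \<in> E" using a(1) by (rule add)
      then show ?case by (simp add: add_ac)
    qed (use x in simp)
    then show "\<exists>a\<in>E. \<exists>b\<in>E. 0 < a \<and> 0 < b \<and> e = a + b"
      using e_eq a xe by (intro bexI[of _ "x + a * j'"] bexI[of _ a]) auto
  qed
qed

section \<open>The Frobenius exponent\<close>

text \<open>\<open>m\<close> belongs to the set whose infimum is the complexity, and the logarithm
  is monotone with value \<open>-\<infinity>\<close> at zero. Finiteness at negative indices comes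
  from \<open>k_nonpos\<close>.\<close>

lemma (in cartier_sub) frobenius_exponent_le:
  assumes fin: "\<And>e. k (int e) \<noteq> \<infinity>"
    and "p > 1" "m > 0"
    and bigo: "(\<lambda>e. real (the_enat (k (int e))) - real (the_enat (k (int e - 1)))) \<in> O(\<lambda>e. m ^ e)"
  shows "frobenius_exponent p R D \<le> ereal (log (real p) m)"
proof -
  have "k e \<noteq> \<infinity>" for e
  proof (cases "e \<le> 0")
    case True
    then show ?thesis by (simp add: k_nonpos)
  next
    case False
    then show ?thesis using fin[of "nat e"] by simp
  qed
  then have "cartier_complexity p R D \<le> ereal m"
    using \<open>m > 0\<close> bigo by (auto simp: cartier_complexity_def intro!: Inf_lower)
  then show ?thesis
    using \<open>p > 1\<close> \<open>m > 0\<close>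
    by (cases "cartier_complexity p R D") (auto simp: frobenius_exponent_def ereal_log_def not_le)
qed

section \<open>Growth of the number of generators\<close>

locale cartier_bound = cartier_operator_setup n p \<theta> \<kappa>
  for n p :: nat and \<theta> :: "'k::field \<Rightarrow> 'k \<Rightarrow> 'k" and \<kappa> :: "nat \<Rightarrow> 'k mpoly \<Rightarrow> 'k mpoly" +
  fixes I :: "'k mpoly set" and D and A
  assumes F_finite: "F_finite_field TYPE('k)"
    and I: "ideal I (poly_ring n)"
    and D: "cartier_subalgebra p (poly_ring n Quot I) D"
    and A: "minimal_generators (poly_ring n) (frobenius_power (poly_ring n) I (p ^ e))
               (fedder_preimage p (poly_ring n) I \<kappa> D e) (A e)"
begin

abbreviation "S \<equiv> poly_ring n"

sublocale S: cring S by (rule cring_poly_ring)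

sublocale D: cartier_sub "S Quot I" p D
  using ideal.quotient_is_cring[OF I cring_poly_ring] D
  by (simp add: cartier_sub_def cartier_sub_axioms_def)

abbreviation "stab e \<equiv> fedder.stab S I (\<kappa> e)"
abbreviation "induced e \<equiv> fedder.induced S I (\<kappa> e)"

lemma homog_in_generate_ring:
  assumes "H \<subseteq> D" and "degree_le (S Quot I) D 0 \<subseteq> D.gen H"
    and "\<And>f. f \<in> A e \<Longrightarrow> f \<in> stab e \<Longrightarrow> induced e f \<in> graded_piece D e \<Longrightarrow>
      homog (S Quot I) e (induced e f) \<in> D.gen H"
    and "\<phi> \<in> graded_piece D e"
  shows "homog (S Quot I) e \<phi> \<in> D.gen H"
proof -
  obtain J :: "(nat \<times> (nat \<Rightarrow>\<^sub>0 nat)) set" and u v where "fedder S I p e (\<kappa> e) J u v"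
    by (rule fedder_poly_ring[OF F_finite I])
  then interpret F: fedder S I p e "\<kappa> e" J u v .
  have "A e \<subseteq> carrier S" and "genideal (S Quot F.Q) ((\<lambda>f. F.Q +>\<^bsub>S\<^esub> f) ` A e)
      = fedder_preimage p S I \<kappa> D e"
    using A[of e] unfolding minimal_generators_def by blast+
  from F.graded_piece_subset_generate_ring[where \<kappa> = \<kappa>, OF D.cartier_sub_axioms assms(1,2) refl this assms(3,4)]
  show ?thesis .
qed

lemma k_Suc_le_card: "D.k (int e) \<noteq> \<infinity> \<Longrightarrow> D.k (int (Suc e)) \<le> D.k (int e) + enat (card (A (Suc e)))"
proof -
  assume "D.k (int e) \<noteq> \<infinity>"
  then obtain X where X: "D.ring_generators (int e) X" and kX: "D.k (int e) = enat (card X)"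
    by (rule D.k_attained)
  \<comment> \<open>The filter gives \<open>?Y \<subseteq> graded_piece D (Suc e)\<close> at once,
    and \<open>homog_in_generate_ring\<close> asks only about such \<open>f\<close>.\<close>
  define B where "B = {f \<in> A (Suc e). induced (Suc e) f \<in> graded_piece D (Suc e)}"
  let ?Y = "induced (Suc e) ` B"
  have fin: "finite (A (Suc e))" using A by (simp add: minimal_generators_def)
  have B: "finite B" "B \<subseteq> A (Suc e)" using fin by (auto simp: B_def)
  have Y: "?Y \<subseteq> graded_piece D (Suc e)" by (auto simp: B_def)
  have "D.k (int (Suc e)) \<le> enat (card X + card ?Y)"
  proof (rule D.k_Suc_le[OF X])
    show "finite ?Y" using B by simp
    show "?Y \<subseteq> graded_piece D (Suc e)" by (rule Y)
    let ?H = "degree_le (S Quot I) D 0 \<union> homog (S Quot I) (Suc e) ` ?Y"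
    fix \<phi> assume \<phi>: "\<phi> \<in> graded_piece D (Suc e)"
    show "homog (S Quot I) (Suc e) \<phi> \<in> D.gen ?H"
    proof (rule homog_in_generate_ring[OF _ _ _ \<phi>])
      show "?H \<subseteq> D" using D.degree_le_subset Y D.graded_piece_iff by blast
      show "degree_le (S Quot I) D 0 \<subseteq> D.gen ?H" by (intro subsetI generate_ring.incl UnI1)
      show "homog (S Quot I) (Suc e) (induced (Suc e) f) \<in> D.gen ?H"
        if "f \<in> A (Suc e)" "induced (Suc e) f \<in> graded_piece D (Suc e)" for f
        using that unfolding B_def by (intro generate_ring.incl UnI2 imageI CollectI conjI)
    qed
  qed
  also have "card ?Y \<le> card (A (Suc e))"
    using card_image_le[OF B(1)] card_mono[OF fin B(2)] le_trans by blast
  then have "enat (card X + card ?Y) \<le> D.k (int e) + enat (card (A (Suc e)))"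
    by (simp add: kX)
  finally show ?thesis .
qed

text \<open>Starting from zero, each degree adds finitely many generators. This rules out the
  \<open>\<infinity>\<close> branch of \<open>cartier_complexity\<close>.\<close>

lemma k_finite: "D.k (int e) \<noteq> \<infinity>"
proof (induction e)
  case 0
  then show ?case by (simp add: D.k_nonpos)
next
  case (Suc e)
  then obtain j where "D.k (int e) = enat j" by auto
  with k_Suc_le_card[OF Suc] show ?case
    by (metis enat_ord_simps(5) infinity_ileE plus_enat_simps(1))
qed

definition increment :: "nat \<Rightarrow> real" where
  "increment e = real (the_enat (D.k (int e))) - real (the_enat (D.k (int e - 1)))"

lemma increment_Suc: "increment (Suc e) = real (the_enat (D.k (int (Suc e)))) - real (the_enat (D.k (int e)))"
  by (simp add: increment_def)

text \<open>\<open>k_mono_Suc\<close> makes the increment nonnegative and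
  \<open>k_Suc_le_card\<close> bounds it above; at \<open>e = 0\<close> both terms vanish.\<close>

lemma abs_increment_le: "\<bar>increment e\<bar> \<le> real (card (A e))"
proof (cases e)
  case 0
  then show ?thesis by (simp add: increment_def D.k_nonpos)
next
  case (Suc e')
  obtain i j where ij: "D.k (int e') = enat i" "D.k (int (Suc e')) = enat j"
    using k_finite[of e'] k_finite[of "Suc e'"] by auto
  have "i \<le> j" using D.k_mono_Suc[OF k_finite, of e'] unfolding ij by simp
  moreover have "j \<le> i + card (A e)"
    using k_Suc_le_card[OF k_finite, of e'] unfolding ij Suc by simp
  ultimately show ?thesis unfolding Suc increment_Suc ij by simp
qed

lemma abs_increment_le_degree: "\<bar>increment e\<bar> \<le> (real (max_degree (A e)) + 1) ^ n"
proof -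
  obtain J :: "(nat \<times> (nat \<Rightarrow>\<^sub>0 nat)) set" and u v where "fedder S I p e (\<kappa> e) J u v"
    by (rule fedder_poly_ring[OF F_finite I])
  then have "ideal (frobenius_power S I (p ^ e)) S" by (rule fedder.ideal_Q)
  from minimal_generators_card_le[OF this A]
  have "real (card (A e)) \<le> real ((max_degree (A e) + 1) ^ n)" by (simp only: of_nat_le_iff)
  with abs_increment_le[of e] show ?thesis by (simp add: add.commute)
qed

text \<open>For \<open>t \<ge> 0\<close> the summand \<open>1\<close> is absorbed by the growing
  bound on the degrees; for \<open>n = 0\<close> both powers are one.\<close>

lemma increment_bigo:
  assumes d: "(\<lambda>e. real (max_degree (A e))) \<in> O(\<lambda>e. real p powr (t * real e))"
    and t: "t \<ge> 0 \<or> n = 0"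
  shows "increment \<in> O(\<lambda>e. (real p powr (t * real n)) ^ e)"
proof -
  have "increment \<in> O(\<lambda>e. (real (max_degree (A e)) + 1) ^ n)"
    using abs_increment_le_degree by (intro bigoI[of _ 1]) simp
  also have "(\<lambda>e. (real (max_degree (A e)) + 1) ^ n) \<in> O(\<lambda>e. (real p powr (t * real e)) ^ n)"
  proof (cases "n = 0")
    case False
    with t have "t \<ge> 0" by simp
    have "p > 1" using p by (rule prime_gt_1_nat)
    have "(\<lambda>e. 1) \<in> O(\<lambda>e. real p powr (t * real e))"
      using \<open>t \<ge> 0\<close> \<open>p > 1\<close> by (intro bigoI[of _ 1]) (simp add: ge_one_powr_ge_zero)
    with d have "(\<lambda>e. real (max_degree (A e)) + 1) \<in> O(\<lambda>e. real p powr (t * real e))"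
      by (intro sum_in_bigo)
    then show ?thesis by (rule landau_o.big_power)
  qed simp
  also have "(\<lambda>e. (real p powr (t * real e)) ^ n) = (\<lambda>e. (real p powr (t * real n)) ^ e)"
    using prime_gt_0_nat[OF p] by (simp add: powr_realpow[symmetric] powr_powr mult_ac fun_eq_iff)
  finally show ?thesis .
qed

section \<open>Negative t: constant generators and degrees containing 1\<close>

definition full_degrees :: "nat set" where
  "full_degrees = {e. 1 \<in> stab e \<and> induced e 1 \<in> graded_piece D e}"

text \<open>By \<open>\<kappa>_comp\<close> the maps induced by the Cartier operators compose like
  the operators themselves, and \<open>D\<close> is closed under products.\<close>

lemma full_degrees_add:
  assumes a: "a \<in> full_degrees" and b: "b \<in> full_degrees"
  shows "a + b \<in> full_degrees"
    and "homog (S Quot I) a (induced a 1) \<otimes>\<^bsub>D.CA\<^esub> homog (S Quot I) b (induced b 1)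
      = homog (S Quot I) (a + b) (induced (a + b) 1)"
proof -
  obtain Ja :: "(nat \<times> (nat \<Rightarrow>\<^sub>0 nat)) set" and ua va where "fedder S I p a (\<kappa> a) Ja ua va"
    by (rule fedder_poly_ring[OF F_finite I])
  then interpret a: fedder S I p a "\<kappa> a" Ja ua va .
  obtain Jb :: "(nat \<times> (nat \<Rightarrow>\<^sub>0 nat)) set" and ub vb where "fedder S I p b (\<kappa> b) Jb ub vb"
    by (rule fedder_poly_ring[OF F_finite I])
  then interpret b: fedder S I p b "\<kappa> b" Jb ub vb .
  obtain J :: "(nat \<times> (nat \<Rightarrow>\<^sub>0 nat)) set" and u v where "fedder S I p (a + b) (\<kappa> (a + b)) J u v"
    by (rule fedder_poly_ring[OF F_finite I])
  then interpret ab: fedder S I p "a + b" "\<kappa> (a + b)" J u v .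
  have 1: "1 \<in> stab a" "1 \<in> stab b" using a b by (simp_all add: full_degrees_def)
  have 2: "1 \<in> stab (a + b)"
    unfolding ab.stab_def
  proof (intro CollectI conjI ballI one_in_poly_ring)
    fix x assume x: "x \<in> I"
    then have "x \<in> carrier S" by (rule a.Icarr)
    have "\<kappa> b x \<in> I" using 1(2) x by (simp add: b.stab_def)
    then have "\<kappa> a (\<kappa> b x) \<in> I" using 1(1) by (simp add: a.stab_def)
    then show "\<kappa> (a + b) (1 \<otimes>\<^bsub>S\<^esub> x) \<in> I" using \<kappa>_comp[OF \<open>x \<in> carrier S\<close>] by simp
  qed
  have eq: "(\<lambda>Y\<in>carrier (S Quot I). induced a 1 (induced b 1 Y)) = induced (a + b) 1"
  proof (rule a.extensional_RI_eqI)
    fix s :: "'k mpoly" assume s: "s \<in> carrier S"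
    then have "\<kappa> b s \<in> carrier S" by (rule b.K_closed)
    with s 1 2 show "(\<lambda>Y\<in>carrier (S Quot I). induced a 1 (induced b 1 Y)) (I +>\<^bsub>S\<^esub> s)
        = induced (a + b) 1 (I +>\<^bsub>S\<^esub> s)"
      using a.coset_closed[OF s]
      by (simp add: a.induced_coset b.induced_coset ab.induced_coset \<kappa>_comp)
  qed (simp_all add: ab.induced_extensional)
  have hD: "homog (S Quot I) a (induced a 1) \<in> D" "homog (S Quot I) b (induced b 1) \<in> D"
    using a b by (simp_all add: full_degrees_def D.graded_piece_iff)
  have "induced a 1 \<in> cartier_maps p (S Quot I) a" "induced b 1 \<in> cartier_maps p (S Quot I) b"
    using D.D_component[OF hD(1), of a] D.D_component[OF hD(2), of b] by (simp_all add: homog_def)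
  from D.homog_mult[OF this]
  show prod: "homog (S Quot I) a (induced a 1) \<otimes>\<^bsub>D.CA\<^esub> homog (S Quot I) b (induced b 1)
      = homog (S Quot I) (a + b) (induced (a + b) 1)"
    unfolding eq .
  have "homog (S Quot I) (a + b) (induced (a + b) 1) \<in> D"
    unfolding prod[symmetric] by (rule D.D_closed(5)[OF hD])
  with 2 show "a + b \<in> full_degrees" by (simp add: full_degrees_def D.graded_piece_iff)
qed

text \<open>If all generators in degree \<open>e\<close> are constants, either they vanish or \<open>1 \<in> J\<^sub>e\<close>; in the latter
  case \<open>\<kappa>\<^sup>e = \<kappa>\<^sup>a \<kappa>\<^sup>b\<close> generates everything.\<close>

lemma increment_eq_0:
  assumes d: "max_degree (A (Suc e)) = 0"
    and dec: "Suc e \<in> full_degrees \<Longrightarrow>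
      \<exists>a\<in>full_degrees. \<exists>b\<in>full_degrees. 0 < a \<and> 0 < b \<and> Suc e = a + b"
  shows "increment (Suc e) = 0"
proof -
  obtain J :: "(nat \<times> (nat \<Rightarrow>\<^sub>0 nat)) set" and u v where "fedder S I p (Suc e) (\<kappa> (Suc e)) J u v"
    by (rule fedder_poly_ring[OF F_finite I])
  then interpret F: fedder S I p "Suc e" "\<kappa> (Suc e)" J u v .
  let ?H = "degree_le (S Quot I) D (int e)"
  have HD: "?H \<subseteq> D" by (rule D.degree_le_subset)
  have 0: "degree_le (S Quot I) D 0 \<subseteq> D.gen ?H"
    using D.degree_le_mono[of 0 "int e"] by (intro subsetI generate_ring.incl) auto
  have M: "ideal {f \<in> stab (Suc e). homog (S Quot I) (Suc e) (induced (Suc e) f) \<in> D.gen H} S"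
    if "H \<subseteq> D" "degree_le (S Quot I) D 0 \<subseteq> D.gen H" for H
    by (rule F.ideal_of_generate_ring[OF D.cartier_sub_axioms that])
  have const: "Poly_Mapping.single 0 c \<in> carrier S" for c
    by (simp add: single_in_poly_ring in_exponents_iff)
  have A_gen: "homog (S Quot I) (Suc e) (induced (Suc e) f) \<in> D.gen ?H"
    if f: "f \<in> A (Suc e)" "f \<in> stab (Suc e)" "induced (Suc e) f \<in> graded_piece D (Suc e)" for f
  proof -
    have "finite (A (Suc e))" using A by (simp add: minimal_generators_def)
    then obtain c where c: "f = Poly_Mapping.single 0 c" using d f(1) by (rule max_degree_0_constant)
    show ?thesis
    proof (cases "c = 0")
      case True
      then have "f = \<zero>\<^bsub>S\<^esub>" using c by simp
      then show ?thesis using additive_subgroup.zero_closed[OF ideal.axioms(1)[OF M[OF HD 0]]] by simp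
    next
      case False
      have "1 = f \<otimes>\<^bsub>S\<^esub> Poly_Mapping.single 0 (1 / c)" using c False by (simp add: mult_single)
      \<comment> \<open>With \<open>H = D\<close> the ideal \<open>M\<close> is the preimage of the
        whole graded piece; it contains a nonzero constant and hence \<open>1\<close>.\<close>
      moreover have "f \<in> {f \<in> stab (Suc e). homog (S Quot I) (Suc e) (induced (Suc e) f) \<in> D.gen D}"
        using f by (auto simp: D.graded_piece_iff intro: generate_ring.incl)
      then have "f \<otimes>\<^bsub>S\<^esub> Poly_Mapping.single 0 (1 / c) \<in>
          {f \<in> stab (Suc e). homog (S Quot I) (Suc e) (induced (Suc e) f) \<in> D.gen D}"
        using const
        by (intro ideal.I_r_closed[OF M]) (auto intro: generate_ring.incl D.degree_le_subset[THEN subsetD])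
      ultimately have 1: "1 \<in> stab (Suc e)" "homog (S Quot I) (Suc e) (induced (Suc e) 1) \<in> D"
        using D.generate_subset_D[OF subset_refl] by auto
      then have "Suc e \<in> full_degrees" by (simp add: full_degrees_def D.graded_piece_iff)
      with dec obtain a b where ab: "a \<in> full_degrees" "b \<in> full_degrees" "0 < a" "0 < b"
        "Suc e = a + b" by blast
      \<comment> \<open>Both summands are positive, so \<open>a\<close> and \<open>b\<close> are at
        most \<open>e\<close> and the product is formed within degrees up to
        \<open>e\<close>.\<close>
      have "homog (S Quot I) i (induced i 1) \<in> ?H" if "i \<in> full_degrees" "i \<le> e" for i
        using that by (auto simp: degree_le_def full_degrees_def D.graded_piece_iff homog_def)
      then have "homog (S Quot I) (a + b) (induced (a + b) 1) \<in> D.gen ?H"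
        unfolding full_degrees_add(2)[OF ab(1,2), symmetric] using ab
        by (intro generate_ring.eng_mult generate_ring.incl) simp_all
      then have "1 \<in> {f \<in> stab (Suc e). homog (S Quot I) (Suc e) (induced (Suc e) f) \<in> D.gen ?H}"
        using 1 ab by simp
      then have "1 \<otimes>\<^bsub>S\<^esub> f \<in> {f \<in> stab (Suc e). homog (S Quot I) (Suc e) (induced (Suc e) f) \<in> D.gen ?H}"
        using const c by (intro ideal.I_r_closed[OF M[OF HD 0]]) simp_all
      then show ?thesis by simp
    qed
  qed
  have "D.k (int (Suc e)) = D.k (int e)"
    using homog_in_generate_ring[OF HD 0 A_gen] by (intro D.k_Suc_eq)
  then show ?thesis unfolding increment_Suc by simp
qed

text \<open>The bound tends to zero, so the degrees, being natural numbers, are eventually zero.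
  From then on \<open>increment_eq_0\<close> applies, and an eventually vanishing sequence is
  dominated by any \<open>g\<close>.\<close>

lemma increment_bigo_neg:
  assumes d: "(\<lambda>e. real (max_degree (A e))) \<in> O(\<lambda>e. real p powr (t * real e))"
    and t: "t < 0"
  shows "increment \<in> O(g)"
proof -
  have "p > 1" using p by (rule prime_gt_1_nat)
  have "real p powr t < 1" using t \<open>p > 1\<close> by (simp add: powr_less_one)
  then have "(\<lambda>e. (real p powr t) ^ e) \<longlonglongrightarrow> 0" by (intro LIMSEQ_power_zero) simp
  moreover have "(\<lambda>e. (real p powr t) ^ e) = (\<lambda>e. real p powr (t * real e))"
    using \<open>p > 1\<close> by (simp add: powr_realpow[symmetric] powr_powr fun_eq_iff)
  ultimately have "(\<lambda>e. real p powr (t * real e)) \<longlonglongrightarrow> 0" by simp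
  then have "(\<lambda>e. real p powr (t * real e)) \<in> o(\<lambda>_. 1)" by (intro smalloI_tendsto) simp_all
  with d have "(\<lambda>e. real (max_degree (A e))) \<in> o(\<lambda>_. 1)" by (rule landau_o.big_small_trans)
  then have "(\<lambda>e. real (max_degree (A e))) \<longlonglongrightarrow> 0" using smalloD_tendsto by fastforce
  then have "eventually (\<lambda>e. real (max_degree (A e)) < 1) sequentially"
    by (rule order_tendstoD) simp
  then obtain N1 where N1: "\<And>e. e \<ge> N1 \<Longrightarrow> max_degree (A e) = 0"
    by (auto simp: eventually_sequentially)
  obtain N2 where N2: "\<And>e. e \<in> full_degrees \<Longrightarrow> e \<ge> N2 \<Longrightarrow>
      \<exists>a\<in>full_degrees. \<exists>b\<in>full_degrees. 0 < a \<and> 0 < b \<and> e = a + b"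
    using additively_closed_eventually_decomposable[OF full_degrees_add(1)] by blast
  have "increment e = 0" if e: "e \<ge> N1 + N2 + 1" for e
  proof -
    obtain e' where "e = Suc e'" using e by (cases e) auto
    then show ?thesis using e by (auto intro!: increment_eq_0 N1 N2)
  qed
  then have "eventually (\<lambda>e. increment e = 0) sequentially"
    unfolding eventually_sequentially by blast
  then show ?thesis by (intro bigoI[of _ 0]) (auto elim: eventually_mono)
qed

end

theorem theorem2p2:
  fixes p n :: nat
    and t :: real
    and \<theta> :: "'k::field \<Rightarrow> 'k \<Rightarrow> 'k"
    and \<kappa> :: "nat \<Rightarrow> 'k mpoly \<Rightarrow> 'k mpoly"
    and I :: "'k mpoly set"
    and D :: "(nat \<Rightarrow> 'k mpoly set \<Rightarrow> 'k mpoly set) set"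
    and A :: "nat \<Rightarrow> 'k mpoly set"
  assumes "CHAR('k) = p" and "p > 0"
    and "F_finite_field TYPE('k)"
    and "frobenius_dual_iso \<theta>"
    and "cartier_operator n (\<theta> 1) \<kappa>"
    and "ideal I (poly_ring n)"
    and "cartier_subalgebra p (poly_ring n Quot I) D"
    and "\<And>e. minimal_generators (poly_ring n) (frobenius_power (poly_ring n) I (p ^ e))
               (fedder_preimage p (poly_ring n) I \<kappa> D e) (A e)"
    and "(\<lambda>e. real (max_degree (A e))) \<in> O(\<lambda>e. real p powr (t * real e))"
  shows "frobenius_exponent p (poly_ring n Quot I) D \<le> ereal (t * real n)"
proof -
  \<comment> \<open>The characteristic of a field is prime as soon as it is positive.\<close>
  have "prime p" using assms(1,2) prime_CHAR_semidom[where 'a = 'k] by simp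
  interpret cartier_bound n p \<theta> \<kappa> I D A
    using assms \<open>prime p\<close>
    by (simp add: cartier_bound_def cartier_bound_axioms_def cartier_operator_setup_def)
  have "p > 1" using \<open>prime p\<close> by (rule prime_gt_1_nat)
  \<comment> \<open>The sign of \<open>t\<close> decides which estimate applies; the logarithm to
    base \<open>p\<close> of this growth rate is \<open>t * n\<close>.\<close>
  have "increment \<in> O(\<lambda>e. (real p powr (t * real n)) ^ e)"
    using increment_bigo[OF assms(9)] increment_bigo_neg[OF assms(9)] by (cases "t < 0") auto
  then have "frobenius_exponent p (poly_ring n Quot I) D \<le> ereal (log (real p) (real p powr (t * real n)))"
    using \<open>p > 1\<close> k_finite by (intro D.frobenius_exponent_le) (simp_all add: increment_def[abs_def])
  then show ?thesis using \<open>p > 1\<close> by simp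
qed

end
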